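(* Let $X\subseteq\{1,\dots,D\}^{\mathbb N}$ be a subshift of finite type given by an aperiodic matrix, with shift map $\sigma$, and let $A:X\to\mathbb R$ be Lipschitz continuous with $A\le 0$ and $m(A)=\max_{\mu}\int A\,d\mu=0$ (maximum over $\sigma$-invariant probability measures). Let $P(\beta)=\sup_{\mu}\{h_\mu(\sigma)+\beta\int A\,d\mu\}$ (supremum over $\sigma$-invariant probability measures) be the pressure function and let $h=\lim_{\beta\to+\infty}P(\beta)$, which is the maximal entropy among $A$-maximizing measures. Then $$\liminf_{\beta\to+\infty}\frac1\beta\log\bigl(P(\beta)-h\bigr)\ \ge\ \sup\bigl\{\lambda(i_1,\dots,i_n)\ :\ n\in\mathbb N^*,\ \Omega_{i_1},\dots,\Omega_{i_n}\text{ distinct irreducible components of the Aubry set with maximal entropy}\bigr\},$$ where $\lambda(i_1,\dots,i_n)$ is the unique max-plus eigenvalue of the $n\times n$ matrix with entries $S^{ext}(j,i)$, $i,j\in\{i_1,\dots,i_n\}$, each of these entries being a (finite) non-positive real number.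
   Context: $X\subseteq\{1,\dots,D\}^{\mathbb N}$ is a one-sided subshift of finite type given by an aperiodic transition matrix, with metric $d(x,y)=2^{-\min\{i:\,x_i\ne y_i\}}$ and shift $\sigma(x_0x_1x_2\dots)=x_1x_2\dots$. $S_n(A)=A+A\circ\sigma+\dots+A\circ\sigma^{n-1}$ is the Birkhoff sum. A $\sigma$-invariant probability measure $\mu$ is $A$-maximizing if $\int A\,d\mu=m(A)$. $h_\mu(\sigma)$ is the Kolmogorov entropy. Mañé potential: $S(x,y)=\lim_{\epsilon\to0}\sup\{S_n(A)(z): n\ge1,\ \sigma^n(z)=y,\ d(x,z)<\epsilon\}$; it is non-positive because $A\le0$. Aubry set: $\Omega=\{x\in X: S(x,x)=0\}$. On $\Omega$, the relation $x\sim y\iff S(x,y)+S(y,x)=0$ is an equivalence relation; its classes $\Omega_i$ are the irreducible components of $\Omega$. A component $\Omega_i$ has maximal entropy if its topological entropy (for $\sigma$) equals $h$. For irreducible components $\Omega_i,\Omega_j$ (possibly $i=j$), $$S^{ext}(j,i)=\inf_{x\in\Omega_i}\ \sup\{S(y,z)+A(z):\ \sigma(z)=x,\ z\notin\Omega_i,\ y\in\Omega_j\}.$$ It is asserted, as a separate result, that each $S^{ext}(j,i)$ is a finite non-positive real number. Max-plus eigenvalue of an $n\times n$ matrix with entries $a_{ij}>-\infty$: the maximal mean value of the entries along cycles, $$\lambda=\max_{l_1,\dots,l_k\text{ all different}}\frac{a_{l_1l_2}+a_{l_2l_3}+\dots+a_{l_{k-1}l_k}+a_{l_kl_1}}{k}$$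 (for $k=1$ the term is $a_{l_1l_1}$).
   Formalization: Finiteness of the entries S^ext(j,i) fails as defined (A=0: Ω=X, empty supremum), so entries may be −∞ and a cycle through such an entry has mean −∞; finiteness is not asserted. h is the limit of P(β); that it is the maximal entropy among A-maximizing measures is not restated. *)

theory Defs
  imports "HOL-Probability.Probability" "HOL-Library.Disjoint_Sets"
begin

section \<open>Subshifts of finite type\<close>

definition shift :: "(nat \<Rightarrow> nat) \<Rightarrow> nat \<Rightarrow> nat" where
  "shift x = (\<lambda>n. x (Suc n))"

definition seq_dist :: "(nat \<Rightarrow> nat) \<Rightarrow> (nat \<Rightarrow> nat) \<Rightarrow> real" where
  "seq_dist x y = (if x = y then 0 else (1/2) ^ (LEAST i. x i \<noteq> y i))"

definition sft :: "nat \<Rightarrow> (nat \<Rightarrow> nat \<Rightarrow> nat) \<Rightarrow> (nat \<Rightarrow> nat) set" where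
  "sft D M = {x. \<forall>i. x i \<in> {1..D} \<and> M (x i) (x (Suc i)) = 1}"

definition transition_matrix :: "nat \<Rightarrow> (nat \<Rightarrow> nat \<Rightarrow> nat) \<Rightarrow> bool" where
  "transition_matrix D M \<longleftrightarrow> (\<forall>i\<in>{1..D}. \<forall>j\<in>{1..D}. M i j \<in> {0, 1})"

primrec mpow :: "nat \<Rightarrow> (nat \<Rightarrow> nat \<Rightarrow> nat) \<Rightarrow> nat \<Rightarrow> nat \<Rightarrow> nat \<Rightarrow> nat" where
  "mpow D M 0 i j = (if i = j then 1 else 0)"
| "mpow D M (Suc k) i j = (\<Sum>l\<in>{1..D}. M i l * mpow D M k l j)"

text \<open>The exponent has to be positive: the zeroth power of the \<open>1 \<times> 1\<close> zero matrix is positive,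
  but its subshift is empty.\<close>

definition aperiodic_matrix :: "nat \<Rightarrow> (nat \<Rightarrow> nat \<Rightarrow> nat) \<Rightarrow> bool" where
  "aperiodic_matrix D M \<longleftrightarrow> (\<exists>k\<ge>1. \<forall>i\<in>{1..D}. \<forall>j\<in>{1..D}. mpow D M k i j > 0)"

text \<open>Lipschitz continuity is with respect to \<^const>\<open>seq_dist\<close>. The library's metric on
  \<^typ>\<open>nat \<Rightarrow> nat\<close> (\<^const>\<open>dist\<close>) is a different one, although it has the same topology.\<close>

definition seq_lipschitz_on :: "(nat \<Rightarrow> nat) set \<Rightarrow> ((nat \<Rightarrow> nat) \<Rightarrow> real) \<Rightarrow> bool" where
  "seq_lipschitz_on X A \<longleftrightarrow> (\<exists>L. \<forall>x\<in>X. \<forall>y\<in>X. \<bar>A x - A y\<bar> \<le> L * seq_dist x y)"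

definition birkhoff_sum :: "((nat \<Rightarrow> nat) \<Rightarrow> real) \<Rightarrow> nat \<Rightarrow> (nat \<Rightarrow> nat) \<Rightarrow> real" where
  "birkhoff_sum A n x = (\<Sum>k<n. A ((shift ^^ k) x))"

section \<open>Invariant measures, entropy and pressure\<close>

text \<open>The product topology of \<^typ>\<open>nat \<Rightarrow> nat\<close> with discrete factors is the topology of
  \<^const>\<open>seq_dist\<close>, so \<^const>\<open>borel\<close> is the intended sigma-algebra.\<close>

definition invariant_measures :: "(nat \<Rightarrow> nat) set \<Rightarrow> (nat \<Rightarrow> nat) measure set" where
  "invariant_measures X =
     {\<mu>. prob_space \<mu> \<and> sets \<mu> = sets (restrict_space borel X) \<and>
         shift \<in> measurable \<mu> \<mu> \<and> distr \<mu> \<mu> shift = \<mu>}"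

definition max_integral :: "(nat \<Rightarrow> nat) set \<Rightarrow> ((nat \<Rightarrow> nat) \<Rightarrow> real) \<Rightarrow> real" where
  "max_integral X A = (SUP \<mu>\<in>invariant_measures X. \<integral>x. A x \<partial>\<mu>)"

definition partition_entropy :: "'a measure \<Rightarrow> 'a set set \<Rightarrow> real" where
  "partition_entropy \<mu> \<xi> = - (\<Sum>C\<in>\<xi>. measure \<mu> C * ln (measure \<mu> C))"

definition dynamical_join :: "'a measure \<Rightarrow> ('a \<Rightarrow> 'a) \<Rightarrow> nat \<Rightarrow> 'a set set \<Rightarrow> 'a set set" where
  "dynamical_join \<mu> T n \<xi> =
     common_refinement ((\<lambda>k. (\<lambda>C. (T ^^ k) -` C \<inter> space \<mu>) ` \<xi>) ` {..<n})"

definition kolmogorov_entropy :: "'a measure \<Rightarrow> ('a \<Rightarrow> 'a) \<Rightarrow> ereal" where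
  "kolmogorov_entropy \<mu> T =
     (SUP \<xi>\<in>{\<xi>. finite \<xi> \<and> \<xi> \<subseteq> sets \<mu> \<and> partition_on (space \<mu>) \<xi>}.
        ereal (lim (\<lambda>n. partition_entropy \<mu> (dynamical_join \<mu> T n \<xi>) / real n)))"

definition pressure :: "(nat \<Rightarrow> nat) set \<Rightarrow> ((nat \<Rightarrow> nat) \<Rightarrow> real) \<Rightarrow> real \<Rightarrow> ereal" where
  "pressure X A \<beta> =
     (SUP \<mu>\<in>invariant_measures X. kolmogorov_entropy \<mu> shift + ereal (\<beta> * (\<integral>x. A x \<partial>\<mu>)))"

definition limit_entropy :: "(nat \<Rightarrow> nat) set \<Rightarrow> ((nat \<Rightarrow> nat) \<Rightarrow> real) \<Rightarrow> ereal" where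
  "limit_entropy X A = Lim at_top (pressure X A)"

text \<open>Topological entropy in the sense of Bowen, by separated sets.\<close>

definition separated_set :: "nat \<Rightarrow> real \<Rightarrow> (nat \<Rightarrow> nat) set \<Rightarrow> bool" where
  "separated_set n \<epsilon> E \<longleftrightarrow>
     (\<forall>x\<in>E. \<forall>y\<in>E. x \<noteq> y \<longrightarrow> (\<exists>k<n. seq_dist ((shift ^^ k) x) ((shift ^^ k) y) > \<epsilon>))"

definition topological_entropy :: "(nat \<Rightarrow> nat) set \<Rightarrow> ereal" where
  "topological_entropy K =
     Lim (at_right 0) (\<lambda>\<epsilon>. limsup (\<lambda>n.
       SUP E\<in>{E. E \<subseteq> K \<and> finite E \<and> E \<noteq> {} \<and> separated_set n \<epsilon> E}.
         ereal (ln (real (card E)) / real n)))"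

section \<open>Mane potential, Aubry set and its irreducible components\<close>

text \<open>The value is \<open>-\<infinity>\<close> for some pairs of points outside the Aubry set.\<close>

definition mane_potential ::
    "(nat \<Rightarrow> nat) set \<Rightarrow> ((nat \<Rightarrow> nat) \<Rightarrow> real) \<Rightarrow> (nat \<Rightarrow> nat) \<Rightarrow> (nat \<Rightarrow> nat) \<Rightarrow> ereal" where
  "mane_potential X A x y =
     Lim (at_right 0) (\<lambda>\<epsilon>.
       Sup {ereal (birkhoff_sum A n z) | n z.
              n \<ge> 1 \<and> z \<in> X \<and> (shift ^^ n) z = y \<and> seq_dist x z < \<epsilon>})"

definition aubry_set :: "(nat \<Rightarrow> nat) set \<Rightarrow> ((nat \<Rightarrow> nat) \<Rightarrow> real) \<Rightarrow> (nat \<Rightarrow> nat) set" where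
  "aubry_set X A = {x\<in>X. mane_potential X A x x = 0}"

definition irreducible_components ::
    "(nat \<Rightarrow> nat) set \<Rightarrow> ((nat \<Rightarrow> nat) \<Rightarrow> real) \<Rightarrow> (nat \<Rightarrow> nat) set set" where
  "irreducible_components X A =
     aubry_set X A // {(x, y). x \<in> aubry_set X A \<and> y \<in> aubry_set X A \<and>
                              mane_potential X A x y + mane_potential X A y x = 0}"

definition maximal_entropy_components ::
    "(nat \<Rightarrow> nat) set \<Rightarrow> ((nat \<Rightarrow> nat) \<Rightarrow> real) \<Rightarrow> (nat \<Rightarrow> nat) set set" where
  "maximal_entropy_components X A =
     {C \<in> irreducible_components X A. topological_entropy C = limit_entropy X A}"

text \<open>The first component argument is the one of \<open>y\<close>, the second the one of \<open>x\<close>. If some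
  \<open>x \<in> Ci\<close> has no preimage outside \<open>Ci\<close>, the supremum is empty and the value is \<open>-\<infinity>\<close>.\<close>

definition S_ext :: "(nat \<Rightarrow> nat) set \<Rightarrow> ((nat \<Rightarrow> nat) \<Rightarrow> real) \<Rightarrow>
    (nat \<Rightarrow> nat) set \<Rightarrow> (nat \<Rightarrow> nat) set \<Rightarrow> ereal" where
  "S_ext X A Cj Ci =
     (INF x\<in>Ci. Sup {mane_potential X A y z + ereal (A z) | y z.
                       z \<in> X \<and> shift z = x \<and> z \<notin> Ci \<and> y \<in> Cj})"

section \<open>Max-plus eigenvalue\<close>

definition cycle_mean :: "(nat \<Rightarrow> nat \<Rightarrow> ereal) \<Rightarrow> nat list \<Rightarrow> ereal" where
  "cycle_mean a ls =
     (\<Sum>t<length ls. a (ls ! t) (ls ! (Suc t mod length ls))) / ereal (real (length ls))"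

text \<open>The maximal cycle mean of a matrix with index set \<open>{0..<n}\<close>. A cycle through an entry \<open>-\<infinity>\<close>
  has mean \<open>-\<infinity>\<close>; on matrices with finite entries this is the usual eigenvalue.\<close>

definition maxplus_eigenvalue :: "nat \<Rightarrow> (nat \<Rightarrow> nat \<Rightarrow> ereal) \<Rightarrow> ereal" where
  "maxplus_eigenvalue n a =
     Max (cycle_mean a ` {ls. ls \<noteq> [] \<and> distinct ls \<and> set ls \<subseteq> {0..<n}})"

definition component_eigenvalue :: "(nat \<Rightarrow> nat) set \<Rightarrow> ((nat \<Rightarrow> nat) \<Rightarrow> real) \<Rightarrow>
    (nat \<Rightarrow> nat) set list \<Rightarrow> ereal" where
  "component_eigenvalue X A Cs =
     maxplus_eigenvalue (length Cs) (\<lambda>p q. S_ext X A (Cs ! q) (Cs ! p))"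

text \<open>Natural logarithm with the convention \<open>log 0 = -\<infinity>\<close>, needed because the pressure may equal
  its limit.\<close>

definition ereal_ln :: "ereal \<Rightarrow> ereal" where
  "ereal_ln x = (if x \<le> 0 then -\<infinity> else if x = \<infinity> then \<infinity> else ereal (ln (real_of_ereal x)))"

end

theory Submission
  imports Defs "HOL-Library.Omega_Words_Fun"
begin

text \<open>
  Since \<open>A \<le> 0\<close>, the Mane potential vanishes between any two points of a component, \<open>A\<close> vanishes on
  the component, and the component is closed and shift-invariant. Let \<open>h\<close> be the maximal entropy. Along
  a cycle of \<open>k\<close> components of entropy \<open>h\<close>, consider points of \<open>X\<close> that follow a word of one component,
  then a transition word of Birkhoff sum almost \<open>S\<^sup>e\<^sup>x\<^sup>t\<close>, then a word of the next component, and so on.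
  By submultiplicativity a component has at least \<open>exp (h * n)\<close> words of length \<open>n\<close>, so with weight
  \<open>exp (- (h + \<delta>) * n)\<close> each visit contributes a factor \<open>1 / \<delta>\<close>, up to a constant, and each transition
  a factor \<open>exp (\<beta> * S\<^sup>e\<^sup>x\<^sup>t)\<close>. The weights of a full turn reach \<open>1\<close> when \<open>\<delta>\<close> is a constant times
  \<open>exp (\<beta> * mean)\<close>, with the mean of \<open>S\<^sup>e\<^sup>x\<^sup>t\<close> over the cycle. The condition \<open>z \<notin> \<Omega>\<^sub>i\<close> in \<open>S\<^sup>e\<^sup>x\<^sup>t\<close> makes these
  words uniquely decodable from right to left, so that, as in the Kraft--McMillan inequality, there are
  enough of them of some common length; concatenating them independently gives an invariant measure
  that shows \<open>P \<beta> \<ge> h + \<delta>\<close>.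
\<close>

section \<open>Words and Birkhoff sums\<close>

text \<open>Two kinds of error have very different prices. A constant factor in the weight of the
  words costs only \<open>ln c / \<beta>\<close>, which vanishes in the limit. An error in a
  Birkhoff sum is multiplied by \<open>\<beta>\<close>, so it has to be arbitrarily small for each
  link, however long the link is. Hence pieces are glued along a common overlap of \<open>m\<close>
  letters: by the Lipschitz condition a junction costs at most \<open>L * (1/2) ^ m\<close>,
  whatever the lengths of the pieces. As \<open>m\<close> is fixed before \<open>\<beta>\<close>,
  only finitely many overlaps and transition words occur, and their number and lengths go into the
  constant.

  A component is closed and invariant but need not be of finite type, so its words are glued in
  \<open>X\<close> and not inside the component. Each visit must begin and end with prescribed
  overlaps, chosen to carry the most weight. The choice depends on \<open>\<delta>\<close>, but the
  infimum over \<open>x\<close> in \<open>S_ext\<close> provides a transition word for every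
  overlap.

  Visits are cut off at a length near \<open>1 / \<delta>\<close>. This keeps a weight of order
  \<open>1 / \<delta>\<close> and bounds the length of a chain, so that few lengths compete.\<close>

declare build_cons [simp del] build_append [simp del]

lemma funpow_shift: "(shift ^^ n) x = suffix n x"
proof (induction n arbitrary: x)
  case (Suc n)
  have "shift x = suffix 1 x" by (simp add: shift_def suffix_def)
  with Suc show ?case by (simp add: funpow_Suc_right del: funpow.simps)
qed simp

lemma shift_eq_suffix: "shift x = suffix 1 x"
  by (simp add: shift_def suffix_def)

lemma prefix_eq_iff: "prefix n x = prefix n y \<longleftrightarrow> (\<forall>i<n. x i = y i)"
  by (auto simp: subsequence_def)

lemma prefix_eq_mono: "prefix n x = prefix n y \<Longrightarrow> k \<le> n \<Longrightarrow> prefix k x = prefix k y"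
  by (simp add: prefix_eq_iff)

lemma prefix_add_eq: "prefix (n + m) x = prefix n x @ prefix m (suffix n x)"
  by (simp add: subsequence_append)

lemma prefix_suffix_1: "prefix (Suc n) x = prefix (Suc n) y \<Longrightarrow> prefix n (suffix 1 x) = prefix n (suffix 1 y)"
  unfolding prefix_eq_iff suffix_nth plus_1_eq_Suc by auto

lemma seq_dist_le: "prefix n x = prefix n y \<Longrightarrow> seq_dist x y \<le> (1/2) ^ n"
proof -
  assume *: "prefix n x = prefix n y"
  have "n \<le> (LEAST i. x i \<noteq> y i)" if "x \<noteq> y"
  proof -
    from that obtain j where "x j \<noteq> y j" by auto
    then have "x (LEAST i. x i \<noteq> y i) \<noteq> y (LEAST i. x i \<noteq> y i)" by (rule LeastI)
    with * show ?thesis unfolding prefix_eq_iff using not_less by blast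
  qed
  then show ?thesis unfolding seq_dist_def by (auto intro: power_decreasing)
qed

lemma prefix_eq_if_seq_dist: "seq_dist x y < (1/2) ^ n \<Longrightarrow> prefix (Suc n) x = prefix (Suc n) y"
proof (rule ccontr)
  assume *: "seq_dist x y < (1/2) ^ n" "prefix (Suc n) x \<noteq> prefix (Suc n) y"
  then obtain i where i: "i < Suc n" "x i \<noteq> y i" unfolding prefix_eq_iff by blast
  then have "(LEAST i. x i \<noteq> y i) \<le> n" using Least_le[of "\<lambda>i. x i \<noteq> y i" i] by simp
  then have "(1/2) ^ n \<le> (1/2::real) ^ (LEAST i. x i \<noteq> y i)" by (intro power_decreasing) auto
  with * i show False by (auto simp: seq_dist_def split: if_splits)
qed

lemma seq_dist_nonneg: "0 \<le> seq_dist x y"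
  by (simp add: seq_dist_def)

lemma birkhoff_sum_suffix: "birkhoff_sum A n x = (\<Sum>k<n. A (suffix k x))"
  by (simp add: birkhoff_sum_def funpow_shift)

lemma birkhoff_sum_add:
  "birkhoff_sum A (n + k) x = birkhoff_sum A n x + birkhoff_sum A k (suffix n x)"
  by (induction k) (simp_all add: birkhoff_sum_suffix add.commute del: suffix_nth)

lemma birkhoff_sum_1: "birkhoff_sum A 1 x = A x"
  by (simp add: birkhoff_sum_suffix lessThan_Suc)

text \<open>The Mane potential and the topological entropy are defined by \<open>Lim\<close>, which
  says nothing unless the limit exists. Monotonicity in the scale provides the limit and identifies
  it.\<close>

lemma Lim_at_right_decreasing:
  fixes f :: "real \<Rightarrow> 'a :: {complete_linorder, linorder_topology}"
  assumes "\<And>e e'. 0 < e \<Longrightarrow> e \<le> e' \<Longrightarrow> f e \<le> f e'"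
  shows "(f \<longlongrightarrow> (INF e\<in>{0<..}. f e)) (at_right 0)"
proof (rule order_tendstoI)
  fix a assume "a < (INF e\<in>{0<..}. f e)"
  then have "\<And>e. e > 0 \<Longrightarrow> a < f e" by (auto dest: less_INF_D)
  then show "eventually (\<lambda>e. a < f e) (at_right 0)"
    by (auto simp: eventually_at_filter)
next
  fix a assume "(INF e\<in>{0<..}. f e) < a"
  then obtain e0 where e0: "e0 > 0" "f e0 < a" by (auto simp: INF_less_iff)
  then show "eventually (\<lambda>e. f e < a) (at_right 0)"
    unfolding eventually_at_right_field using assms by (meson le_less_trans less_imp_le)
qed

lemma Lim_at_right_increasing:
  fixes f :: "real \<Rightarrow> 'a :: {complete_linorder, linorder_topology}"
  assumes "\<And>e e'. 0 < e \<Longrightarrow> e \<le> e' \<Longrightarrow> f e' \<le> f e"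
  shows "(f \<longlongrightarrow> (SUP e\<in>{0<..}. f e)) (at_right 0)"
proof (rule order_tendstoI)
  fix a assume "a > (SUP e\<in>{0<..}. f e)"
  then have "\<And>e. e > 0 \<Longrightarrow> f e < a" by (auto dest: SUP_lessD)
  then show "eventually (\<lambda>e. f e < a) (at_right 0)"
    by (auto simp: eventually_at_filter)
next
  fix a assume "(SUP e\<in>{0<..}. f e) > a"
  then obtain e0 where e0: "e0 > 0" "a < f e0" by (auto simp: less_SUP_iff)
  then show "eventually (\<lambda>e. a < f e) (at_right 0)"
    unfolding eventually_at_right_field using assms by (meson less_le_trans less_imp_le)
qed

section \<open>Gluing points of the subshift, and the Lipschitz bound for Birkhoff sums\<close>

locale sft_potential =
  fixes D :: nat and M :: "nat \<Rightarrow> nat \<Rightarrow> nat" and A :: "(nat \<Rightarrow> nat) \<Rightarrow> real"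
    and X :: "(nat \<Rightarrow> nat) set" and L :: real
  assumes X_def: "X = sft D M"
    and lip: "\<And>x y. x \<in> X \<Longrightarrow> y \<in> X \<Longrightarrow> \<bar>A x - A y\<bar> \<le> L * seq_dist x y"
    and L_nonneg: "0 \<le> L"
    and A_nonpos: "\<And>x. x \<in> X \<Longrightarrow> A x \<le> 0"
begin

lemma X_iff: "x \<in> X \<longleftrightarrow> (\<forall>i. x i \<in> {1..D} \<and> M (x i) (x (Suc i)) = 1)"
  by (simp add: X_def sft_def)

lemma suffix_in_X: "x \<in> X \<Longrightarrow> suffix n x \<in> X"
  by (simp add: X_iff)

lemma X_closed:
  assumes "\<And>n. \<exists>y\<in>X. prefix n y = prefix n x"
  shows "x \<in> X"
  unfolding X_iff
proof
  fix i
  obtain y where "y \<in> X" "prefix (i + 2) y = prefix (i + 2) x" using assms by blast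
  then show "x i \<in> {1..D} \<and> M (x i) (x (Suc i)) = 1" unfolding X_iff prefix_eq_iff
    by (metis add_2_eq_Suc' less_Suc_eq)
qed

lemma conc_in_X:
  assumes "z \<in> X" "x \<in> X" "x 0 = z n"
  shows "prefix n z \<frown> x \<in> X"
  unfolding X_iff
proof
  fix i
  consider "Suc i < n" | "Suc i = n" | "n \<le> i" by linarith
  then show "(prefix n z \<frown> x) i \<in> {1..D} \<and> M ((prefix n z \<frown> x) i) ((prefix n z \<frown> x) (Suc i)) = 1"
  proof cases
    case 1 then show ?thesis using assms(1) by (simp add: X_iff)
  next
    case 2 then show ?thesis using assms(1,3) by (auto simp: X_iff)
  next
    case 3 then show ?thesis using assms(2) by (simp add: X_iff Suc_diff_le)
  qed
qed

text \<open>One shared letter makes the junction admissible; this is why the overlap has length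
  \<open>Suc m\<close>.\<close>

lemma conc_prefix:
  assumes "z \<in> X" "x \<in> X" "prefix (Suc m) x = prefix (Suc m) (suffix n z)"
  shows "prefix n z \<frown> x \<in> X" "prefix (n + Suc m) (prefix n z \<frown> x) = prefix (n + Suc m) z"
proof -
  have *: "x i = z (n + i)" if "i < Suc m" for i
    using assms(3) that unfolding prefix_eq_iff by simp
  show "prefix n z \<frown> x \<in> X" using *[of 0] assms by (intro conc_in_X) auto
  show "prefix (n + Suc m) (prefix n z \<frown> x) = prefix (n + Suc m) z"
    unfolding prefix_eq_iff
  proof (intro allI impI)
    fix i assume "i < n + Suc m"
    then show "(prefix n z \<frown> x) i = z i" by (cases "i < n") (auto simp: *)
  qed
qed

lemma lip_prefix:
  assumes "x \<in> X" "y \<in> X" "prefix n x = prefix n y"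
  shows "\<bar>A x - A y\<bar> \<le> L * (1/2) ^ n"
  using lip[OF assms(1,2)] mult_left_mono[OF seq_dist_le[OF assms(3)] L_nonneg] by linarith

text \<open>The iterates agree on \<open>n + m\<close>, \<open>n + m - 1\<close>, ...,
  \<open>m + 1\<close> letters, so the errors form a geometric series whose sum does not depend on
  \<open>n\<close>.\<close>

lemma birkhoff_lip:
  assumes "x \<in> X" "y \<in> X" "prefix (n + m) x = prefix (n + m) y"
  shows "\<bar>birkhoff_sum A n x - birkhoff_sum A n y\<bar> \<le> L * (1/2) ^ m"
proof -
  \<comment> \<open>The factor \<open>1 - (1/2) ^ n\<close> is the exact partial sum of that series
    and makes the induction close.\<close>
  have gen: "\<bar>birkhoff_sum A n x - birkhoff_sum A n y\<bar> \<le> L * (1/2) ^ m * (1 - (1/2) ^ n)"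
    if "x \<in> X" "y \<in> X" "prefix (n + m) x = prefix (n + m) y" for x y n
    using that
  proof (induction n arbitrary: x y)
    case 0
    then show ?case by (simp add: birkhoff_sum_suffix)
  next
    case (Suc n)
    have eq: "birkhoff_sum A (Suc n) z = A z + birkhoff_sum A n (suffix 1 z)" for z
      using birkhoff_sum_add[of A 1 n z] unfolding birkhoff_sum_1 by simp
    have "prefix (n + m) (suffix 1 x) = prefix (n + m) (suffix 1 y)"
      by (intro prefix_suffix_1) (use Suc.prems(3) in simp)
    then have IH: "\<bar>birkhoff_sum A n (suffix 1 x) - birkhoff_sum A n (suffix 1 y)\<bar>
        \<le> L * (1/2) ^ m * (1 - (1/2) ^ n)"
      using Suc.IH Suc.prems suffix_in_X by blast
    have "\<bar>A x - A y\<bar> \<le> L * (1/2) ^ (Suc n + m)"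
      using lip_prefix Suc.prems by blast
    moreover have "L * (1/2) ^ (Suc n + m) = L * (1/2) ^ m * (1/2) ^ n / 2"
      and "L * (1/2) ^ m * (1 - (1/2) ^ Suc n) = L * (1/2) ^ m - L * (1/2) ^ m * (1/2) ^ n / 2"
      and "L * (1/2) ^ m * (1 - (1/2) ^ n) = L * (1/2) ^ m - L * (1/2) ^ m * (1/2) ^ n"
      by (simp_all add: algebra_simps power_add)
    ultimately show ?case unfolding eq using IH by linarith
  qed
  have "L * (1/2) ^ m * (1 - (1/2) ^ n) \<le> L * (1/2) ^ m * 1"
    using L_nonneg by (intro mult_left_mono) auto
  with gen[OF assms] show ?thesis by simp
qed

lemma birkhoff_nonpos: "x \<in> X \<Longrightarrow> birkhoff_sum A n x \<le> 0"
  unfolding birkhoff_sum_suffix by (intro sum_nonpos A_nonpos suffix_in_X)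

lemma exists_small: "0 < e \<Longrightarrow> \<exists>m0. \<forall>m\<ge>m0. L * (1/2) ^ m < (e::real)"
proof -
  assume e: "0 < e"
  have "(\<lambda>m. L * (1/2) ^ m) \<longlonglongrightarrow> L * 0" by (intro tendsto_intros LIMSEQ_power_zero) auto
  then have "eventually (\<lambda>m. L * (1/2) ^ m < e) sequentially" using e by (simp add: order_tendstoD)
  then show ?thesis by (simp add: eventually_sequentially)
qed

section \<open>The Mane potential and the Aubry set\<close>

text \<open>For \<open>N = 1\<close> this is the inequality \<open>S(x,y) \<ge> s\<close> freed of
  limits and of the value \<open>-\<infinity>\<close>. A larger \<open>N\<close> forces long
  paths.\<close>

definition connects :: "nat \<Rightarrow> (nat \<Rightarrow> nat) \<Rightarrow> (nat \<Rightarrow> nat) \<Rightarrow> real \<Rightarrow> bool" where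
  "connects N x y s \<longleftrightarrow> (\<forall>m. \<forall>\<eta>>0. \<exists>n\<ge>N. \<exists>z\<in>X. suffix n z = y \<and> prefix m z = prefix m x \<and>
     birkhoff_sum A n z > s - \<eta>)"

lemma mane_potential_INF:
  "mane_potential X A x y = (INF \<epsilon>\<in>{0<..}. Sup {ereal (birkhoff_sum A n z) | n z.
              n \<ge> 1 \<and> z \<in> X \<and> (shift ^^ n) z = y \<and> seq_dist x z < \<epsilon>})"
  unfolding mane_potential_def
proof (rule tendsto_Lim)
  show "((\<lambda>\<epsilon>. Sup {ereal (birkhoff_sum A n z) | n z.
              n \<ge> 1 \<and> z \<in> X \<and> (shift ^^ n) z = y \<and> seq_dist x z < \<epsilon>}) \<longlongrightarrow>
     (INF \<epsilon>\<in>{0<..}. Sup {ereal (birkhoff_sum A n z) | n z.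
              n \<ge> 1 \<and> z \<in> X \<and> (shift ^^ n) z = y \<and> seq_dist x z < \<epsilon>})) (at_right 0)"
    by (rule Lim_at_right_decreasing) (rule Sup_subset_mono, fastforce)
qed simp

lemma mane_nonpos: "mane_potential X A x y \<le> 0"
  unfolding mane_potential_INF
  by (rule INF_lower2[of 1]) (auto intro!: Sup_least simp: birkhoff_nonpos)

lemma mane_ge_iff: "ereal s \<le> mane_potential X A x y \<longleftrightarrow> connects 1 x y s"
proof
  assume s: "ereal s \<le> mane_potential X A x y"
  show "connects 1 x y s" unfolding connects_def
  proof (intro allI impI)
    fix m and \<eta> :: real assume "\<eta> > 0"
    then have "ereal (s - \<eta>) < ereal s" by simp
    also have "ereal s \<le> Sup {ereal (birkhoff_sum A n z) | n z.
              n \<ge> 1 \<and> z \<in> X \<and> (shift ^^ n) z = y \<and> seq_dist x z < (1/2)^m}"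
      using s unfolding mane_potential_INF by (simp add: le_INF_iff)
    finally obtain n z where "n \<ge> 1" "z \<in> X" "(shift ^^ n) z = y" "seq_dist x z < (1/2)^m"
      "s - \<eta> < birkhoff_sum A n z" by (auto simp: less_Sup_iff)
    then show "\<exists>n\<ge>1. \<exists>z\<in>X. suffix n z = y \<and> prefix m z = prefix m x \<and> birkhoff_sum A n z > s - \<eta>"
      using prefix_eq_if_seq_dist[of x z m] prefix_eq_mono[of x "Suc m" z m]
      by (intro exI[of _ n] conjI bexI[of _ z]) (auto simp: funpow_shift)
  qed
next
  assume c: "connects 1 x y s"
  show "ereal s \<le> mane_potential X A x y" unfolding mane_potential_INF
  proof (rule INF_greatest)
    fix \<epsilon> :: real assume "\<epsilon> \<in> {0<..}"
    then have "\<epsilon> > 0" by simp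
    then obtain m where m: "(1/2::real) ^ m < \<epsilon>" using real_arch_pow_inv[of \<epsilon> "1/2"] by auto
    show "ereal s \<le> Sup {ereal (birkhoff_sum A n z) | n z.
              n \<ge> 1 \<and> z \<in> X \<and> (shift ^^ n) z = y \<and> seq_dist x z < \<epsilon>}" (is "_ \<le> ?S")
    proof (rule ereal_le_epsilon2)
      fix \<eta> :: real assume "\<eta> > 0"
      then obtain n z where *: "n \<ge> 1" "z \<in> X" "suffix n z = y" "prefix m z = prefix m x"
        "birkhoff_sum A n z > s - \<eta>" using c unfolding connects_def by blast
      have "seq_dist x z < \<epsilon>" using seq_dist_le[of x m z] m *(4) by simp
      then have "ereal (birkhoff_sum A n z) \<le> ?S"
        using * by (intro Sup_upper) (auto simp: funpow_shift)
      moreover have "ereal s \<le> ereal (birkhoff_sum A n z) + ereal \<eta>" using *(5) by simp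
      ultimately show "ereal s \<le> ?S + ereal \<eta>"
        by (meson add_right_mono order_trans)
    qed
  qed
qed

lemma mane_eq_0_iff: "mane_potential X A x y = 0 \<longleftrightarrow> connects 1 x y 0"
  using mane_ge_iff[of 0 x y] mane_nonpos[of x y] by (auto simp: zero_ereal_def)

text \<open>This is the superadditivity of the Mane potential: the second path starts so close to
  \<open>y\<close> that it can replace the tail of the first path at a cost below
  \<open>\<eta>/3\<close>.\<close>

lemma connects_trans:
  assumes "connects N x y s" "connects N' y z t"
  shows "connects (N + N') x z (s + t)"
  unfolding connects_def
proof (intro allI impI)
  fix m and \<eta> :: real assume \<eta>: "\<eta> > 0"
  then obtain k where k: "L * (1/2) ^ k < \<eta>/3" using exists_small[of "\<eta>/3"] by auto
  \<comment> \<open>\<open>k\<close> letters beyond the junction protect the sum along the first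
    path, \<open>m\<close> letters protect its beginning even if that path is shorter than
    \<open>m\<close>, and one more makes the overlap non-empty.\<close>
  define k' where "k' = Suc (k + m)"
  obtain n1 w1 where 1: "n1 \<ge> N" "w1 \<in> X" "suffix n1 w1 = y" "prefix m w1 = prefix m x"
    "birkhoff_sum A n1 w1 > s - \<eta>/3" using assms(1) \<eta> unfolding connects_def
    by (meson divide_pos_pos zero_less_numeral)
  obtain n2 w2 where 2: "n2 \<ge> N'" "w2 \<in> X" "suffix n2 w2 = z" "prefix k' w2 = prefix k' y"
    "birkhoff_sum A n2 w2 > t - \<eta>/3" using assms(2) \<eta> unfolding connects_def
    by (meson divide_pos_pos zero_less_numeral)
  define w where "w = prefix n1 w1 \<frown> w2"
  have y0: "prefix (Suc (k + m)) w2 = prefix (Suc (k + m)) (suffix n1 w1)"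
    using 1(3) 2(4) by (simp add: k'_def)
  have wX: "w \<in> X" and ag: "prefix (n1 + Suc (k + m)) w = prefix (n1 + Suc (k + m)) w1"
    using conc_prefix[OF 1(2) 2(2) y0] by (simp_all add: w_def)
  have "\<bar>birkhoff_sum A n1 w - birkhoff_sum A n1 w1\<bar> \<le> L * (1/2) ^ k"
    using ag wX 1(2) by (intro birkhoff_lip) (auto intro: prefix_eq_mono)
  moreover have suf: "suffix n1 w = w2" by (simp add: w_def)
  ultimately have "birkhoff_sum A (n1 + n2) w > s + t - \<eta>"
    using 1(5) 2(5) k unfolding birkhoff_sum_add suf by linarith
  moreover have "prefix m w = prefix m w1" using ag by (rule prefix_eq_mono) simp
  moreover have "suffix (n1 + n2) w = z" using 2(3) suf by (metis suffix_suffix)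
  ultimately show "\<exists>n\<ge>N + N'. \<exists>w\<in>X. suffix n w = z \<and> prefix m w = prefix m x \<and>
      birkhoff_sum A n w > s + t - \<eta>"
    using 1(1,4) 2(1) wX by (intro exI[of _ "n1 + n2"]) auto
qed

lemma connects_weaken: "connects N x y s \<Longrightarrow> t \<le> s \<Longrightarrow> N' \<le> N \<Longrightarrow> connects N' x y t"
  unfolding connects_def by (meson diff_right_mono le_less_trans order_trans)

lemma connects_trans_0: "connects 1 x y 0 \<Longrightarrow> connects 1 y z 0 \<Longrightarrow> connects 1 x z 0"
  using connects_weaken[OF connects_trans[of 1 x y 0 1 z 0]] by simp

lemma connects_closed_left:
  assumes "\<And>m. \<exists>x'. prefix m x' = prefix m x \<and> connects N x' y s"
  shows "connects N x y s"
  unfolding connects_def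
proof (intro allI impI)
  fix m and \<eta> :: real assume "\<eta> > 0"
  moreover obtain x' where "prefix m x' = prefix m x" "connects N x' y s" using assms by blast
  ultimately show "\<exists>n\<ge>N. \<exists>z\<in>X. suffix n z = y \<and> prefix m z = prefix m x \<and> birkhoff_sum A n z > s - \<eta>"
    unfolding connects_def by metis
qed

lemma connects_loop: "connects 1 x x 0 \<Longrightarrow> connects N x x 0"
proof (induction N)
  case 0
  then show ?case by (rule connects_weaken) auto
next
  case (Suc N)
  then show ?case using connects_trans[of 1 x x 0 N x 0] by simp
qed

text \<open>Moving the end point of a path moves its starting point by exponentially less in the length
  of the path, so the paths have to be long.\<close>

lemma connects_move_right:
  assumes "connects 1 x x 0" "connects 1 x y s"
    and "y \<in> X" "y' \<in> X" "prefix (Suc m) y' = prefix (Suc m) y"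
  shows "connects 1 x y' (s - L * (1/2) ^ m)"
  unfolding connects_def
proof (intro allI impI)
  fix k and \<eta> :: real assume \<eta>: "\<eta> > 0"
  have "connects (k + 1) x y (0 + s)"
    using connects_trans[OF connects_loop[OF assms(1), of k] assms(2)] by simp
  then obtain n z where z: "n \<ge> k + 1" "z \<in> X" "suffix n z = y" "prefix k z = prefix k x"
    "birkhoff_sum A n z > s - \<eta>" using \<eta> unfolding connects_def by fastforce
  define w where "w = prefix n z \<frown> y'"
  have wX: "w \<in> X" and ag: "prefix (n + Suc m) w = prefix (n + Suc m) z"
    using conc_prefix[OF z(2) assms(4), of m n] assms(5) z(3) by (simp_all add: w_def)
  have "\<bar>birkhoff_sum A n w - birkhoff_sum A n z\<bar> \<le> L * (1/2) ^ m"
    using ag wX z(2) by (intro birkhoff_lip) (auto intro: prefix_eq_mono)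
  moreover have "prefix k w = prefix k z" using ag by (rule prefix_eq_mono) (use z(1) in simp)
  moreover have "suffix n w = y'" by (simp add: w_def)
  ultimately show "\<exists>n\<ge>1. \<exists>w\<in>X. suffix n w = y' \<and> prefix k w = prefix k x \<and>
      birkhoff_sum A n w > s - L * (1/2) ^ m - \<eta>"
    using z wX by (intro exI[of _ n]) auto
qed

section \<open>The Aubry set and its irreducible components\<close>

lemma aubry_iff: "x \<in> aubry_set X A \<longleftrightarrow> x \<in> X \<and> connects 1 x x 0"
  by (simp add: aubry_set_def mane_eq_0_iff)

text \<open>A path from near \<open>x\<close> back to \<open>x\<close> can have a sum arbitrarily
  close to 0. All its terms are non-positive, so the leading one, which is close to
  \<open>A x\<close>, is itself close to 0.\<close>

lemma A_eq_0:
  assumes "x \<in> aubry_set X A"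
  shows "A x = 0"
proof -
  have x: "x \<in> X" "connects 1 x x 0" using assms by (simp_all add: aubry_iff)
  have "- A x \<le> \<epsilon>" if \<epsilon>: "\<epsilon> > 0" for \<epsilon>
  proof -
    obtain m where m: "L * (1/2) ^ m < \<epsilon>/2" using exists_small[of "\<epsilon>/2"] \<epsilon> by auto
    obtain n z where z: "n \<ge> 1" "z \<in> X" "prefix m z = prefix m x" "birkhoff_sum A n z > 0 - \<epsilon>/2"
      using x(2) \<epsilon> unfolding connects_def by (meson half_gt_zero)
    have "birkhoff_sum A n z = A z + birkhoff_sum A (n - 1) (suffix 1 z)"
      using birkhoff_sum_add[of A 1 "n - 1" z] z(1) unfolding birkhoff_sum_1 by simp
    moreover have "birkhoff_sum A (n - 1) (suffix 1 z) \<le> 0"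
      by (intro birkhoff_nonpos suffix_in_X z)
    ultimately have "A z > - \<epsilon>/2" using z(4) by linarith
    moreover have "\<bar>A z - A x\<bar> \<le> L * (1/2) ^ m" using z x by (intro lip_prefix)
    ultimately show ?thesis using m by linarith
  qed
  then have "- A x \<le> 0" using field_le_epsilon[of "- A x" 0] by simp
  then show ?thesis using A_nonpos[OF x(1)] by simp
qed

text \<open>The single step from \<open>x\<close> to its image costs \<open>A x = 0\<close>. For the
  way back, a loop at \<open>x\<close> without its initial step is taken; this drops a non-positive
  term.\<close>

lemma connects_suffix_1:
  assumes "x \<in> aubry_set X A"
  shows "connects 1 x (suffix 1 x) 0" "connects 1 (suffix 1 x) x 0"
proof -
  have x: "x \<in> X" "connects 1 x x 0" using assms by (simp_all add: aubry_iff)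
  show "connects 1 x (suffix 1 x) 0"
    unfolding connects_def
    by (intro allI impI exI[of _ 1]) (use x A_eq_0[OF assms] birkhoff_sum_1[of A x] in auto)
  show "connects 1 (suffix 1 x) x 0"
    unfolding connects_def
  proof (intro allI impI)
    fix m and \<eta> :: real assume \<eta>: "\<eta> > 0"
    \<comment> \<open>Length 2 leaves a path of positive length once the initial step is
      removed.\<close>
    obtain n z where z: "n \<ge> 2" "z \<in> X" "suffix n z = x" "prefix (Suc m) z = prefix (Suc m) x"
      "birkhoff_sum A n z > 0 - \<eta>" using connects_loop[OF x(2), of 2] \<eta> unfolding connects_def by blast
    have "birkhoff_sum A n z = A z + birkhoff_sum A (n - 1) (suffix 1 z)"
      using birkhoff_sum_add[of A 1 "n - 1" z] z(1) unfolding birkhoff_sum_1 by simp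
    then have "birkhoff_sum A (n - 1) (suffix 1 z) > 0 - \<eta>" using z A_nonpos[OF z(2)] by linarith
    moreover have "suffix (n - 1) (suffix 1 z) = x" using z(1,3) by (simp del: suffix_nth)
    moreover have "prefix m (suffix 1 z) = prefix m (suffix 1 x)"
      by (intro prefix_suffix_1 z(4))
    ultimately show "\<exists>n\<ge>1. \<exists>z\<in>X. suffix n z = x \<and> prefix m z = prefix m (suffix 1 x) \<and>
        birkhoff_sum A n z > 0 - \<eta>"
      using z suffix_in_X by (intro exI[of _ "n - 1"] conjI bexI[of _ "suffix 1 z"]) auto
  qed
qed

text \<open>Two non-positive extended reals add up to 0 only if both are 0, so equivalence means
  zero cost in both directions.\<close>

lemma component_obtain:
  assumes "C \<in> irreducible_components X A"
  obtains x where "x \<in> C" "x \<in> X" "connects 1 x x 0"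
    "C = {y \<in> X. connects 1 x y 0 \<and> connects 1 y x 0}"
proof -
  obtain x where x: "x \<in> aubry_set X A"
    and C: "C = {y. y \<in> aubry_set X A \<and> mane_potential X A x y + mane_potential X A y x = 0}"
    using assms unfolding irreducible_components_def quotient_def by auto
  have 0: "a + b = 0 \<longleftrightarrow> a = 0 \<and> b = 0" if "a \<le> 0" "b \<le> 0" for a b :: ereal
    using that by (cases a; cases b) auto
  have "C = {y \<in> X. connects 1 x y 0 \<and> connects 1 y x 0}"
    unfolding C aubry_iff 0[OF mane_nonpos mane_nonpos] mane_eq_0_iff
    using connects_trans_0 by blast
  then show thesis using x that unfolding aubry_iff by blast
qed

lemma component_connects:
  assumes "C \<in> irreducible_components X A" "x \<in> C" "y \<in> C"
  shows "connects 1 x y 0"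
proof -
  obtain x0 where "x0 \<in> C" "x0 \<in> X" "connects 1 x0 x0 0"
    "C = {y \<in> X. connects 1 x0 y 0 \<and> connects 1 y x0 0}"
    by (rule component_obtain[OF assms(1)])
  then show ?thesis using assms(2,3) connects_trans_0 by blast
qed

lemma component_subset_X: "C \<in> irreducible_components X A \<Longrightarrow> C \<subseteq> X"
  by (erule component_obtain) blast

lemma component_subset: "C \<in> irreducible_components X A \<Longrightarrow> C \<subseteq> aubry_set X A"
  using component_subset_X[of C] component_connects[of C] unfolding aubry_iff subset_iff by blast

lemma component_nonempty: "C \<in> irreducible_components X A \<Longrightarrow> C \<noteq> {}"
  by (erule component_obtain) blast

lemma component_memI:
  assumes "C \<in> irreducible_components X A" "x \<in> C" "y \<in> X" "connects 1 x y 0" "connects 1 y x 0"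
  shows "y \<in> C"
proof -
  obtain x0 where "x0 \<in> C" "x0 \<in> X" "connects 1 x0 x0 0"
    "C = {y \<in> X. connects 1 x0 y 0 \<and> connects 1 y x0 0}"
    by (rule component_obtain[OF assms(1)])
  then show ?thesis using assms(2-5) connects_trans_0 by blast
qed

lemma component_suffix:
  assumes "C \<in> irreducible_components X A" "x \<in> C"
  shows "suffix n x \<in> C"
proof (induction n)
  case (Suc n)
  have "suffix (Suc n) x = suffix 1 (suffix n x)" by (simp del: suffix_nth)
  moreover have "suffix n x \<in> aubry_set X A" using Suc component_subset[OF assms(1)] by blast
  ultimately show ?case
    using component_memI[OF assms(1) Suc, of "suffix 1 (suffix n x)"] connects_suffix_1[of "suffix n x"]
      suffix_in_X[of "suffix n x" 1] by (simp add: aubry_iff del: suffix_suffix suffix_nth)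
qed (use assms in simp)

lemma component_birkhoff:
  assumes "C \<in> irreducible_components X A" "x \<in> C"
  shows "birkhoff_sum A n x = 0"
  unfolding birkhoff_sum_suffix using component_suffix[OF assms] component_subset[OF assms(1)] A_eq_0
  by (intro sum.neutral) blast

text \<open>The two directions are not symmetric. A path only has to start near \<open>x\<close>, so
  paths from nearby points of \<open>C\<close> serve for \<open>x\<close>. A path to
  \<open>x\<close> must end exactly there, which requires moving the end point.\<close>

lemma component_closed:
  assumes C: "C \<in> irreducible_components X A" and "\<And>n. \<exists>y\<in>C. prefix n y = prefix n x"
  shows "x \<in> C"
proof -
  have x: "x \<in> X" using assms(2) component_subset_X[OF C] by (intro X_closed) blast
  obtain y where y: "y \<in> C" using component_nonempty[OF C] by blast
  have 1: "connects 1 x y 0"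
    using assms(2) component_connects[OF C _ y] by (intro connects_closed_left) metis
  have "connects 1 y x 0" unfolding connects_def
  proof (intro allI impI)
    fix k and \<eta> :: real assume \<eta>: "\<eta> > 0"
    then obtain m where m: "L * (1/2) ^ m < \<eta>/2" using exists_small[of "\<eta>/2"] by auto
    obtain x' where x': "x' \<in> C" "prefix (Suc m) x' = prefix (Suc m) x" using assms(2) by blast
    have "connects 1 y x (0 - L * (1/2) ^ m)"
      using component_connects[OF C] x' x y component_subset_X[OF C]
      by (intro connects_move_right[where y = x']) auto
    then obtain n z where "n \<ge> 1" "z \<in> X" "suffix n z = x" "prefix k z = prefix k y"
      "birkhoff_sum A n z > 0 - L * (1/2) ^ m - \<eta>/2" using \<eta> unfolding connects_def by (meson half_gt_zero)
    moreover from this m have "birkhoff_sum A n z > 0 - \<eta>" by linarith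
    ultimately show "\<exists>n\<ge>1. \<exists>z\<in>X. suffix n z = x \<and> prefix k z = prefix k y \<and> birkhoff_sum A n z > 0 - \<eta>"
      by blast
  qed
  from component_memI[OF C y x this 1] show ?thesis .
qed

end

section \<open>The stationary measure of a block code\<close>

definition concat_words :: "nat \<Rightarrow> (nat \<Rightarrow> nat list) \<Rightarrow> nat \<Rightarrow> nat" where
  "concat_words N \<omega> = (\<lambda>i. \<omega> (i div N) ! (i mod N))"

lemma suffix_concat_words:
  assumes "N \<ge> 1"
  shows "suffix N (concat_words N \<omega>) = concat_words N (suffix 1 \<omega>)"
  using assms by (simp add: concat_words_def suffix_def)

lemma concat_words_unroll:
  assumes "N \<ge> 1" "length (\<omega> 0) = N"
  shows "concat_words N \<omega> = \<omega> 0 \<frown> concat_words N (suffix 1 \<omega>)"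
proof
  fix i
  show "concat_words N \<omega> i = (\<omega> 0 \<frown> concat_words N (suffix 1 \<omega>)) i"
  proof (cases "i < N")
    case False
    then show ?thesis using assms by (simp add: concat_words_def le_div_geq le_mod_geq)
  qed (use assms in \<open>simp add: concat_words_def\<close>)
qed

text \<open>Words of one common length are decoded by position, so any finite set of them whose free
  concatenations stay in \<open>X\<close> yields entropy \<open>ln (card V) / N\<close>.\<close>

locale block_code =
  fixes X :: "(nat \<Rightarrow> nat) set" and D N :: nat and V :: "nat list set"
  assumes N_pos: "N \<ge> 1"
    and X_bounded: "\<And>x i. x \<in> X \<Longrightarrow> x i \<in> {1..D}"
    and X_suffix: "\<And>x n. x \<in> X \<Longrightarrow> suffix n x \<in> X"
    and V_finite: "finite V" and V_nonempty: "V \<noteq> {}"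
    and V_length: "\<And>v. v \<in> V \<Longrightarrow> length v = N"
    and concat_in_X: "\<And>\<omega>. (\<And>i. \<omega> i \<in> V) \<Longrightarrow> concat_words N \<omega> \<in> X"
begin

definition words_measure :: "(nat \<Rightarrow> nat list) measure" where
  "words_measure = PiM UNIV (\<lambda>_. uniform_count_measure V)"

text \<open>Concatenating independent words gives a measure invariant under the \<open>N\<close>-th power of the
  shift; a uniformly distributed offset below \<open>N\<close> makes it stationary.\<close>

definition offset_measure :: "(nat \<times> (nat \<Rightarrow> nat list)) measure" where
  "offset_measure = uniform_count_measure {..<N} \<Otimes>\<^sub>M words_measure"

definition block_measure :: "(nat \<Rightarrow> nat) measure" where
  "block_measure = distr offset_measure (restrict_space borel X) (\<lambda>(j, \<omega>). suffix j (concat_words N \<omega>))"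

interpretation W: product_prob_space "\<lambda>_::nat. uniform_count_measure V" UNIV
  by (intro product_prob_spaceI prob_space_uniform_count_measure V_finite V_nonempty)

interpretation P: prob_space words_measure
  unfolding words_measure_def by (rule W.prob_space_axioms)

interpretation U: prob_space "uniform_count_measure {..<N}"
  using N_pos by (intro prob_space_uniform_count_measure) (auto simp: lessThan_empty_iff)

interpretation Q: pair_prob_space "uniform_count_measure {..<N}" words_measure ..

interpretation O: prob_space offset_measure
  unfolding offset_measure_def by (rule Q.prob_space_axioms)

lemma space_words: "space words_measure = {\<omega>. \<forall>i. \<omega> i \<in> V}"
  by (auto simp: words_measure_def space_PiM space_uniform_count_measure)

lemma space_offset: "space offset_measure = {..<N} \<times> {\<omega>. \<forall>i. \<omega> i \<in> V}"
  by (simp add: offset_measure_def space_pair_measure space_words space_uniform_count_measure)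

lemma suffix_concat_in_X: "\<omega> \<in> space words_measure \<Longrightarrow> suffix j (concat_words N \<omega>) \<in> X"
  by (intro X_suffix concat_in_X) (simp add: space_words)

lemma suffix_concat_measurable:
  "(\<lambda>\<omega>. suffix j (concat_words N \<omega>)) \<in> measurable words_measure (restrict_space borel X)"
proof (rule measurable_restrict_space2)
  show "(\<lambda>\<omega>. suffix j (concat_words N \<omega>)) \<in> space words_measure \<rightarrow> X"
    using suffix_concat_in_X by auto
  show "(\<lambda>\<omega>. suffix j (concat_words N \<omega>)) \<in> borel_measurable words_measure"
  proof (rule measurable_coordinatewise_then_product)
    fix i
    have 1: "(\<lambda>\<omega>. \<omega> ((j + i) div N)) \<in> measurable words_measure (uniform_count_measure V)"
      unfolding words_measure_def by (rule measurable_component_singleton) simp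
    have 2: "(\<lambda>w. w ! ((j + i) mod N)) \<in> borel_measurable (uniform_count_measure V)"
      by (rule measurableI) (auto simp: sets_uniform_count_measure space_uniform_count_measure)
    show "(\<lambda>\<omega>. suffix j (concat_words N \<omega>) i) \<in> borel_measurable words_measure"
      using measurable_compose[OF 1 2] by (simp add: concat_words_def)
  qed
qed

lemma offset_measurable:
  "(\<lambda>(j, \<omega>). suffix j (concat_words N \<omega>)) \<in> measurable offset_measure (restrict_space borel X)"
proof -
  have "(\<lambda>(j, \<omega>). suffix j (concat_words N \<omega>)) \<in>
      measurable (count_space {..<N} \<Otimes>\<^sub>M words_measure) (restrict_space borel X)"
    using suffix_concat_measurable by (intro measurable_pair_measure_countable1) auto
  moreover have "sets offset_measure = sets (count_space {..<N} \<Otimes>\<^sub>M words_measure)"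
    unfolding offset_measure_def by (intro sets_pair_measure_cong) (auto simp: sets_uniform_count_measure)
  ultimately show ?thesis by (simp cong: measurable_cong_sets)
qed

interpretation B: prob_space block_measure
  unfolding block_measure_def by (rule O.prob_space_distr[OF offset_measurable])

lemma prob_space_block: "prob_space block_measure"
  by (rule B.prob_space_axioms)

lemma sets_block: "sets block_measure = sets (restrict_space borel X)"
  by (simp add: block_measure_def)

lemma space_block: "space block_measure = X"
  by (simp add: block_measure_def space_restrict_space)

lemma integrable_words:
  assumes "f \<in> borel_measurable (restrict_space borel X)" "\<And>x. x \<in> X \<Longrightarrow> \<bar>f x\<bar> \<le> (K::real)"
  shows "integrable words_measure (\<lambda>\<omega>. f (suffix j (concat_words N \<omega>)))"
  using assms measurable_compose[OF suffix_concat_measurable assms(1)] suffix_concat_in_X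
  by (intro P.integrable_const_bound[of _ K]) auto

lemma integral_block:
  assumes f: "f \<in> borel_measurable (restrict_space borel X)" "\<And>x. x \<in> X \<Longrightarrow> \<bar>f x\<bar> \<le> (K::real)"
  shows "(\<integral>x. f x \<partial>block_measure) =
    (\<Sum>j<N. \<integral>\<omega>. f (suffix j (concat_words N \<omega>)) \<partial>words_measure) / N"
proof -
  let ?g = "\<lambda>(j, \<omega>). suffix j (concat_words N \<omega>)"
  have int: "integrable offset_measure (\<lambda>p. f (?g p))"
    using f(2) measurable_compose[OF offset_measurable f(1)]
    by (intro O.integrable_const_bound[of _ K] AE_I2) (auto simp: space_offset space_words intro!: f(2) suffix_concat_in_X)
  have "(\<integral>x. f x \<partial>block_measure) = (\<integral>p. f (?g p) \<partial>offset_measure)"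
    unfolding block_measure_def by (rule integral_distr[OF offset_measurable f(1)])
  also have "\<dots> = (\<integral>j. \<integral>\<omega>. f (?g (j, \<omega>)) \<partial>words_measure \<partial>uniform_count_measure {..<N})"
    using int unfolding offset_measure_def by (rule Q.integral_fst'[symmetric])
  also have "\<dots> = (\<Sum>j<N. \<integral>\<omega>. f (suffix j (concat_words N \<omega>)) \<partial>words_measure) / N"
    by (simp add: integral_uniform_count_measure)
  finally show ?thesis .
qed

section \<open>Invariance of the block measure\<close>

lemma words_shift_invariant: "distr words_measure words_measure (suffix 1) = words_measure"
proof -
  have "suffix 1 = (\<lambda>\<omega> :: nat \<Rightarrow> nat list. \<lambda>n\<in>UNIV. \<omega> (Suc n))" by (simp add: fun_eq_iff)
  then show ?thesis
    using distr_PiM_reindex[of UNIV "\<lambda>_. uniform_count_measure V" Suc UNIV] W.M.prob_space_axioms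
    by (simp add: words_measure_def)
qed

lemma suffix_1_measurable_words: "suffix 1 \<in> measurable words_measure words_measure"
  unfolding words_measure_def suffix_def by (intro measurable_PiM_single') (auto simp: space_PiM space_uniform_count_measure)

lemma shift_measurable: "shift \<in> measurable (restrict_space borel X) (restrict_space borel X)"
proof (rule measurable_restrict_space3)
  show "shift \<in> measurable borel borel"
    unfolding shift_def by (intro measurable_coordinatewise_then_product measurable_product_coordinates)
  show "shift \<in> X \<rightarrow> X" using X_suffix by (auto simp: shift_eq_suffix)
qed

lemma measure_block:
  assumes "E \<in> sets (restrict_space borel X)"
  shows "measure block_measure E =
    (\<Sum>j<N. measure words_measure {\<omega>\<in>space words_measure. suffix j (concat_words N \<omega>) \<in> E}) / N"
proof -
  have "measure words_measure {\<omega>\<in>space words_measure. suffix j (concat_words N \<omega>) \<in> E} =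
      (\<integral>\<omega>. indicator E (suffix j (concat_words N \<omega>)) \<partial>words_measure)" for j
  proof -
    have "(\<integral>\<omega>. indicator E (suffix j (concat_words N \<omega>)) \<partial>words_measure) =
      (\<integral>\<omega>. indicator {\<omega>\<in>space words_measure. suffix j (concat_words N \<omega>) \<in> E} \<omega> \<partial>words_measure :: real)"
      by (intro Bochner_Integration.integral_cong) (auto simp: indicator_def)
    also have "\<dots> = measure words_measure {\<omega>\<in>space words_measure. suffix j (concat_words N \<omega>) \<in> E}"
      by (subst Bochner_Integration.integral_indicator) (rule arg_cong[where f = "measure words_measure"], blast)
    finally show ?thesis by simp
  qed
  moreover have "measure block_measure E = (\<integral>x. indicator E x \<partial>block_measure)"
    using assms sets_block sets.sets_into_space[of E block_measure] by (simp add: Int_absorb2)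
  moreover have "indicator E \<in> borel_measurable (restrict_space borel X)"
    using assms by (rule borel_measurable_indicator)
  ultimately show ?thesis
    using integral_block[of "indicator E" 1] by (simp add: indicator_def)
qed

text \<open>The shift raises the offset by one, so the sum over the offsets telescopes to the
  difference between offsets \<open>N\<close> and 0. These two agree because skipping
  \<open>N\<close> letters is skipping one whole word of a stationary sequence of words.\<close>

lemma block_invariant: "distr block_measure block_measure shift = block_measure"
proof (rule measure_eqI)
  fix E assume "E \<in> sets (distr block_measure block_measure shift)"
  then have E: "E \<in> sets (restrict_space borel X)" by (simp add: sets_block)
  have sh: "shift \<in> measurable block_measure block_measure"
    using shift_measurable by (simp add: sets_block cong: measurable_cong_sets)
  interpret S: prob_space "distr block_measure block_measure shift"
    by (rule B.prob_space_distr[OF sh])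
  define p where "p j = measure words_measure {\<omega>\<in>space words_measure. suffix j (concat_words N \<omega>) \<in> E}" for j
  have "measure (distr block_measure block_measure shift) E = measure block_measure (shift -` E \<inter> X)"
    using E sh by (simp add: measure_distr sets_block space_block)
  also have "\<dots> = (\<Sum>j<N. measure words_measure
      {\<omega>\<in>space words_measure. suffix j (concat_words N \<omega>) \<in> shift -` E \<inter> X}) / N"
    using measurable_sets[OF shift_measurable E] by (intro measure_block) (simp add: space_restrict_space)
  also have "\<dots> = (\<Sum>j<N. p (Suc j)) / N"
    unfolding p_def using suffix_concat_in_X
    by (intro arg_cong2[where f = "(/)"] sum.cong refl arg_cong2[where f = measure])
      (auto simp: shift_eq_suffix simp del: suffix_nth)
  also have "(\<Sum>j<N. p (Suc j)) = (\<Sum>j<N. p j) + p N - p 0"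
    using sum.lessThan_Suc[of p N] sum.lessThan_Suc_shift[of p N] by simp
  also have "p N = p 0"
  proof -
    let ?F = "{\<omega>\<in>space words_measure. suffix 0 (concat_words N \<omega>) \<in> E}"
    have F: "?F \<in> sets words_measure"
      using measurable_sets[OF suffix_concat_measurable[of 0] E] by (simp add: vimage_def Int_def conj_commute)
    have "p 0 = measure (distr words_measure words_measure (suffix 1)) ?F"
      unfolding words_shift_invariant p_def ..
    also have "\<dots> = measure words_measure (suffix 1 -` ?F \<inter> space words_measure)"
      by (rule measure_distr[OF suffix_1_measurable_words F])
    also have "suffix 1 -` ?F \<inter> space words_measure =
        {\<omega>\<in>space words_measure. suffix N (concat_words N \<omega>) \<in> E}"
      using suffix_concat_words[OF N_pos] by (auto simp: space_words)
    finally show ?thesis by (simp add: p_def)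
  qed
  also have "(\<Sum>j<N. p j) + p 0 - p 0 = (\<Sum>j<N. p j)" by simp
  also have "\<dots> / N = measure block_measure E" using measure_block[OF E] by (simp add: p_def)
  finally show "emeasure (distr block_measure block_measure shift) E = emeasure block_measure E"
    by (simp add: S.emeasure_eq_measure B.emeasure_eq_measure)
qed simp

lemma block_measure_invariant: "block_measure \<in> invariant_measures X"
  unfolding invariant_measures_def
  using prob_space_block sets_block block_invariant shift_measurable
  by (simp cong: measurable_cong_sets)

text \<open>Averaging over the offset turns the integral into the expected Birkhoff sum over one
  word, divided by \<open>N\<close>.\<close>

lemma integral_block_ge:
  assumes f: "f \<in> borel_measurable (restrict_space borel X)" "\<And>x. x \<in> X \<Longrightarrow> \<bar>f x\<bar> \<le> (K::real)"
    and s: "\<And>\<omega>. (\<And>i. \<omega> i \<in> V) \<Longrightarrow> s \<le> birkhoff_sum f N (concat_words N \<omega>)"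
  shows "s / N \<le> (\<integral>x. f x \<partial>block_measure)"
proof -
  have "s \<le> (\<integral>\<omega>. (\<Sum>j<N. f (suffix j (concat_words N \<omega>))) \<partial>words_measure)"
    using s f by (intro P.integral_ge_const Bochner_Integration.integrable_sum integrable_words[of f K] AE_I2)
      (auto simp: space_words birkhoff_sum_suffix)
  also have "\<dots> = (\<Sum>j<N. \<integral>\<omega>. f (suffix j (concat_words N \<omega>)) \<partial>words_measure)"
    by (intro Bochner_Integration.integral_sum integrable_words[of f K] f)
  finally show ?thesis using integral_block[OF f(1), of K] f(2) by (simp add: divide_right_mono)
qed

section \<open>Cylinder probabilities\<close>

lemma prob_words:
  assumes "finite J" "\<And>i. i \<in> J \<Longrightarrow> v i \<in> V"
  shows "measure words_measure {\<omega>\<in>space words_measure. \<forall>i\<in>J. \<omega> i = v i} = (1 / card V) ^ card J"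
proof -
  have "{\<omega>\<in>space words_measure. \<forall>i\<in>J. \<omega> i = v i} = W.emb UNIV J (Pi\<^sub>E J (\<lambda>i. {v i}))"
    by (auto simp: prod_emb_def words_measure_def space_PiM PiE_def Pi_def extensional_def restrict_def)
  then show ?thesis
    using assms W.measure_PiM_emb[of J "\<lambda>i. {v i}"]
    by (simp add: words_measure_def sets_uniform_count_measure measure_uniform_count_measure V_finite)
qed

lemma cylinder_sets: "{x\<in>X. prefix n x = w} \<in> sets (restrict_space borel X)"
proof -
  have "{x \<in> space borel. x i = w ! i} \<in> sets (borel :: (nat \<Rightarrow> nat) measure)" for i
    using measurable_sets[OF measurable_product_coordinates, of "{w ! i}" i] by (simp add: vimage_def)
  then have "{x \<in> space borel. \<forall>i\<in>{..<n}. x i = w ! i} \<in> sets (borel :: (nat \<Rightarrow> nat) measure)"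
    by (intro sets.sets_Collect_finite_All) auto
  moreover have "{x. prefix n x = w} =
      (if length w = n then {x \<in> space borel. \<forall>i\<in>{..<n}. x i = w ! i} else {})"
    by (auto simp: list_eq_iff_nth_eq)
  ultimately have "{x. prefix n x = w} \<in> sets (borel :: (nat \<Rightarrow> nat) measure)"
    by simp
  then show ?thesis unfolding sets_restrict_space by (rule image_eqI[rotated]) blast
qed

definition cyl_prob :: "nat \<Rightarrow> nat list \<Rightarrow> real" where
  "cyl_prob n w = measure block_measure {x\<in>X. prefix n x = w}"

lemma cyl_prob_eq: "cyl_prob n w =
    (\<Sum>j<N. measure words_measure {\<omega>\<in>space words_measure. prefix n (suffix j (concat_words N \<omega>)) = w}) / N"
  unfolding cyl_prob_def measure_block[OF cylinder_sets]
  using suffix_concat_in_X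
  by (intro arg_cong2[where f = "(/)"] sum.cong refl arg_cong2[where f = measure]) (auto simp del: subsequence_shift)

lemma cylinder_in_words:
  "{\<omega>\<in>space words_measure. prefix n (suffix j (concat_words N \<omega>)) = w} \<in> sets words_measure"
proof -
  have "{\<omega>\<in>space words_measure. prefix n (suffix j (concat_words N \<omega>)) = w} =
     (\<lambda>\<omega>. suffix j (concat_words N \<omega>)) -` {x\<in>X. prefix n x = w} \<inter> space words_measure"
    using suffix_concat_in_X by (auto simp del: subsequence_shift)
  then show ?thesis using measurable_sets[OF suffix_concat_measurable cylinder_sets] by simp
qed

lemma fixed_words_in: "finite J \<Longrightarrow> {\<omega>\<in>space words_measure. \<forall>i\<in>J. \<omega> i = v i} \<in> sets words_measure"
proof -
  assume "finite J"
  moreover have "{\<omega>\<in>space words_measure. \<omega> i = v i} \<in> sets words_measure" for i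
  proof -
    have 1: "(\<lambda>\<omega>. \<omega> i) \<in> measurable words_measure (uniform_count_measure V)"
      unfolding words_measure_def by (rule measurable_component_singleton) simp
    have "(\<lambda>\<omega>. \<omega> i) -` ({v i} \<inter> V) \<inter> space words_measure \<in> sets words_measure"
      by (rule measurable_sets[OF 1]) (simp add: sets_uniform_count_measure)
    moreover have "(\<lambda>\<omega>. \<omega> i) -` ({v i} \<inter> V) \<inter> space words_measure = {\<omega>\<in>space words_measure. \<omega> i = v i}"
      by (auto simp: space_words)
    ultimately show ?thesis by simp
  qed
  ultimately show ?thesis by (intro sets.sets_Collect_finite_All) auto
qed

text \<open>Word 0 may be cut by the offset, but a window of this length contains the words
  \<open>1, ..., r\<close> completely and therefore determines them.\<close>

lemma cyl_prob_upper:
  assumes "(r + 1) * N \<le> n"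
  shows "cyl_prob n w \<le> (1 / card V) ^ r"
proof -
  have "measure words_measure {\<omega>\<in>space words_measure. prefix n (suffix j (concat_words N \<omega>)) = w}
      \<le> (1 / card V) ^ r" (is "measure _ ?S \<le> _") if j: "j < N" for j
  proof (cases "?S = {}")
    case False
    then obtain \<omega>0 where \<omega>0: "\<omega>0 \<in> ?S" by blast
    have "?S \<subseteq> {\<omega>\<in>space words_measure. \<forall>i\<in>{1..r}. \<omega> i = \<omega>0 i}"
    proof
      fix \<omega> assume \<omega>: "\<omega> \<in> ?S"
      have "\<omega> i = \<omega>0 i" if i: "i \<in> {1..r}" for i
      proof (rule nth_equalityI)
        have len: "length (\<omega> i) = N" "length (\<omega>0 i) = N"
          using \<omega> \<omega>0 V_length by (auto simp: space_words)
        show "length (\<omega> i) = length (\<omega>0 i)" using len by simp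
        fix l assume "l < length (\<omega> i)"
        then have l: "l < N" using len by simp
        have "N \<le> i * N" using i by simp
        moreover have "i * N \<le> r * N" using i by (intro mult_right_mono) auto
        moreover have "r * N + N \<le> n" using assms by simp
        ultimately have *: "j \<le> i * N + l" "i * N + l - j < n" using l j by linarith+
        have "prefix n (suffix j (concat_words N \<omega>)) = prefix n (suffix j (concat_words N \<omega>0))"
          using \<omega> \<omega>0 by simp
        then have "concat_words N \<omega> (i * N + l) = concat_words N \<omega>0 (i * N + l)"
          using * unfolding prefix_eq_iff suffix_nth by (metis le_add_diff_inverse)
        then show "\<omega> i ! l = \<omega>0 i ! l" using l by (simp add: concat_words_def)
      qed
      then show "\<omega> \<in> {\<omega>\<in>space words_measure. \<forall>i\<in>{1..r}. \<omega> i = \<omega>0 i}" using \<omega> by simp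
    qed
    then have "measure words_measure ?S \<le> measure words_measure {\<omega>\<in>space words_measure. \<forall>i\<in>{1..r}. \<omega> i = \<omega>0 i}"
      by (intro P.finite_measure_mono fixed_words_in) auto
    also have "\<dots> = (1 / card V) ^ r"
      using \<omega>0 by (subst prob_words) (auto simp: space_words)
    finally show ?thesis .
  next
    case True
    then show ?thesis unfolding True by simp
  qed
  then have "(\<Sum>j<N. measure words_measure {\<omega>\<in>space words_measure. prefix n (suffix j (concat_words N \<omega>)) = w})
     \<le> (\<Sum>j<N. (1 / card V) ^ r)" by (intro sum_mono) auto
  then show ?thesis unfolding cyl_prob_eq using N_pos by (simp add: divide_le_eq mult.commute)
qed

text \<open>If \<open>w\<close> is possible, it occurs at some offset, and the window then lies
  within the initial \<open>R\<close> words; prescribing these is enough. The factor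
  \<open>1 / N\<close> is the probability of that offset.\<close>

lemma cyl_prob_lower:
  assumes "N + n \<le> R * N" "cyl_prob n w > 0"
  shows "(1 / card V) ^ R / N \<le> cyl_prob n w"
proof -
  let ?S = "\<lambda>j. {\<omega>\<in>space words_measure. prefix n (suffix j (concat_words N \<omega>)) = w}"
  have "\<exists>j<N. measure words_measure (?S j) > 0"
  proof (rule ccontr)
    assume "\<not> ?thesis"
    then have "(\<Sum>j<N. measure words_measure (?S j)) \<le> 0"
      by (intro sum_nonpos) (meson lessThan_iff not_less)
    with assms(2) show False unfolding cyl_prob_eq by (simp add: zero_less_divide_iff)
  qed
  then obtain j where j: "j < N" "measure words_measure (?S j) > 0" by blast
  then obtain \<omega>0 where \<omega>0: "\<omega>0 \<in> ?S j" by (metis (no_types, lifting) equals0I less_irrefl measure_empty)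
  have "{\<omega>\<in>space words_measure. \<forall>i\<in>{..<R}. \<omega> i = \<omega>0 i} \<subseteq> ?S j"
  proof (intro subsetI CollectI conjI)
    fix \<omega> assume \<omega>: "\<omega> \<in> {\<omega>\<in>space words_measure. \<forall>i\<in>{..<R}. \<omega> i = \<omega>0 i}"
    then show "\<omega> \<in> space words_measure" by simp
    have "prefix n (suffix j (concat_words N \<omega>)) = prefix n (suffix j (concat_words N \<omega>0))"
      unfolding prefix_eq_iff
    proof (intro allI impI)
      fix i assume "i < n"
      then have "(j + i) div N < R" using j assms(1) N_pos by (simp add: div_less_iff_less_mult)
      then show "suffix j (concat_words N \<omega>) i = suffix j (concat_words N \<omega>0) i"
        using \<omega> by (simp add: concat_words_def)
    qed
    then show "prefix n (suffix j (concat_words N \<omega>)) = w" using \<omega>0 by simp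
  qed
  then have "measure words_measure {\<omega>\<in>space words_measure. \<forall>i\<in>{..<R}. \<omega> i = \<omega>0 i} \<le> measure words_measure (?S j)"
    by (intro P.finite_measure_mono cylinder_in_words)
  moreover have "measure words_measure {\<omega>\<in>space words_measure. \<forall>i\<in>{..<R}. \<omega> i = \<omega>0 i} = (1 / card V) ^ R"
    using \<omega>0 by (subst prob_words) (auto simp: space_words)
  moreover have "measure words_measure (?S j) \<le> (\<Sum>j<N. measure words_measure (?S j))"
    using j by (intro member_le_sum) auto
  ultimately show ?thesis unfolding cyl_prob_eq using N_pos by (simp add: divide_right_mono)
qed

lemma finite_prefixes: "finite (prefix n ` X)"
proof (rule finite_subset)
  show "prefix n ` X \<subseteq> {w. set w \<subseteq> {1..D} \<and> length w = n}" using X_bounded by auto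
qed (simp add: finite_lists_length_eq)

lemma sum_cyl_prob: "(\<Sum>w\<in>prefix n ` X. cyl_prob n w) = 1"
proof -
  have "(\<Sum>w\<in>prefix n ` X. cyl_prob n w) = measure block_measure (\<Union>w\<in>prefix n ` X. {x\<in>X. prefix n x = w})"
    unfolding cyl_prob_def
    by (rule B.finite_measure_finite_Union[symmetric])
      (use finite_prefixes cylinder_sets sets_block in \<open>auto simp: disjoint_family_on_def\<close>)
  also have "(\<Union>w\<in>prefix n ` X. {x\<in>X. prefix n x = w}) = space block_measure" by (auto simp: space_block)
  finally show ?thesis by (simp add: B.prob_space)
qed

section \<open>Entropy of the block measure\<close>

definition letter_partition :: "(nat \<Rightarrow> nat) set set" where
  "letter_partition = (\<lambda>a. {x\<in>X. x 0 = a}) ` ((\<lambda>x. x 0) ` X)"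

lemma letter_partition:
  "finite letter_partition" "letter_partition \<subseteq> sets block_measure"
  "partition_on (space block_measure) letter_partition"
proof -
  have sub: "(\<lambda>x. x 0) ` X \<subseteq> {1..D}" using X_bounded by blast
  show "finite letter_partition"
    unfolding letter_partition_def by (rule finite_imageI[OF finite_subset[OF sub]]) simp
  have "{x\<in>X. x 0 = a} \<in> sets (restrict_space borel X)" for a
    using cylinder_sets[of 1 "[a]"] by (simp add: subsequence_def)
  then show "letter_partition \<subseteq> sets block_measure"
    by (auto simp: letter_partition_def sets_block)
  show "partition_on (space block_measure) letter_partition"
    by (rule partition_onI) (auto simp: letter_partition_def space_block disjnt_def)
qed

text \<open>\<open>common_refinement\<close> takes a set of partitions, in which the pullbacks for
  different times may coincide, so its choice functions select a piece for each partition and not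
  for each time. The case \<open>n = 0\<close> is left out because the empty intersection is the
  whole type and not \<open>X\<close>.\<close>

lemma dynamical_join_letters:
  assumes "n \<ge> 1"
  shows "dynamical_join block_measure shift n letter_partition =
    (\<lambda>w. {x\<in>X. prefix n x = w}) ` (prefix n ` X)"
proof -
  let ?P = "\<lambda>k. (\<lambda>C. (shift ^^ k) -` C \<inter> space block_measure) ` letter_partition"
  have piece: "(shift ^^ k) -` {x\<in>X. x 0 = a} \<inter> space block_measure = {y\<in>X. y k = a}" for k a
    using X_suffix by (auto simp: funpow_shift space_block)
  have elem: "E = {y\<in>X. y k = x k}" "x \<in> X" if "E \<in> ?P k" "x \<in> E" for E k x
  proof -
    have "E \<in> (\<lambda>x. {y\<in>X. y k = x 0}) ` X"
      using that(1) unfolding letter_partition_def image_image piece .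
    then obtain a where "E = {y\<in>X. y k = a}" by blast
    with that(2) show "E = {y\<in>X. y k = x k}" "x \<in> X" by auto
  qed
  have part: "{y\<in>X. y k = x k} \<in> ?P k" if "x \<in> X" for x k
  proof -
    have "{y\<in>X. y k = x k} \<in> (\<lambda>x. {y\<in>X. y k = x 0}) ` X"
      using X_suffix[OF that, of k] by (intro image_eqI[of _ _ "suffix k x"]) auto
    then show ?thesis unfolding letter_partition_def image_image piece .
  qed
  have inter: "\<Inter> (f ` (?P ` {..<n})) = {y\<in>X. prefix n y = prefix n x}"
    if f: "\<And>k. k < n \<Longrightarrow> f (?P k) \<in> ?P k" "\<And>k. k < n \<Longrightarrow> x \<in> f (?P k)" for f x
  proof -
    have "f (?P k) = {y\<in>X. y k = x k}" if "k < n" for k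
      using elem(1)[OF f(1)[OF that] f(2)[OF that]] .
    then have "\<Inter> (f ` (?P ` {..<n})) = (\<Inter>k\<in>{..<n}. {y\<in>X. y k = x k})" by simp
    also have "\<dots> = {y\<in>X. prefix n y = prefix n x}"
    proof -
      have "0 \<in> {..<n}" using assms by simp
      then show ?thesis unfolding prefix_eq_iff by blast
    qed
    finally show ?thesis .
  qed
  have dj: "dynamical_join block_measure shift n letter_partition =
      (\<Union>f\<in>(\<Pi> P\<in>?P ` {..<n}. P). {\<Inter> (f ` (?P ` {..<n}))}) - {{}}"
    unfolding dynamical_join_def common_refinement ..
  show ?thesis
  proof (intro equalityI subsetI)
    fix E assume "E \<in> dynamical_join block_measure shift n letter_partition"
    then obtain f where f: "f \<in> (\<Pi> P\<in>?P ` {..<n}. P)" and E: "E = \<Inter> (f ` (?P ` {..<n}))" and "E \<noteq> {}"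
      unfolding dj by blast
    then obtain x where x: "x \<in> E" by blast
    have fP: "f (?P k) \<in> ?P k" if "k < n" for k using f that by blast
    have xP: "x \<in> f (?P k)" if "k < n" for k using x that unfolding E by blast
    have "E = {y\<in>X. prefix n y = prefix n x}" unfolding E by (rule inter[OF fP xP])
    moreover have "x \<in> X" using elem(2)[OF fP xP, of 0] assms by simp
    ultimately show "E \<in> (\<lambda>w. {x\<in>X. prefix n x = w}) ` (prefix n ` X)" by blast
  next
    fix E assume "E \<in> (\<lambda>w. {x\<in>X. prefix n x = w}) ` (prefix n ` X)"
    then obtain x where x: "x \<in> X" and E: "E = {y\<in>X. prefix n y = prefix n x}" by blast
    define f where "f P = (SOME F. F \<in> P \<and> x \<in> F)" for P :: "(nat \<Rightarrow> nat) set set"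
    have "f (?P k) \<in> ?P k \<and> x \<in> f (?P k)" for k
      unfolding f_def by (rule someI[of _ "{y\<in>X. y k = x k}"]) (use part[OF x] x in simp)
    then have f: "f (?P k) \<in> ?P k" "x \<in> f (?P k)" for k by blast+
    have "E = \<Inter> (f ` (?P ` {..<n}))" unfolding E by (rule inter[OF f, symmetric])
    moreover have "f \<in> (\<Pi> P\<in>?P ` {..<n}. P)" using f by blast
    moreover have "E \<noteq> {}" using x E by blast
    ultimately show "E \<in> dynamical_join block_measure shift n letter_partition"
      unfolding dj by blast
  qed
qed

lemma partition_entropy_letters:
  assumes "n \<ge> 1"
  shows "partition_entropy block_measure (dynamical_join block_measure shift n letter_partition) =
    (\<Sum>w\<in>prefix n ` X. - (cyl_prob n w * ln (cyl_prob n w)))"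
proof -
  have "inj_on (\<lambda>w. {x\<in>X. prefix n x = w}) (prefix n ` X)"
    by (rule inj_onI) blast
  then show ?thesis
    unfolding partition_entropy_def dynamical_join_letters[OF assms]
    by (simp add: sum.reindex cyl_prob_def sum_negf)
qed

lemma card_V_ge_1: "1 \<le> real (card V)"
  using V_finite V_nonempty by (simp add: Suc_le_eq card_gt_0_iff)

text \<open>A distribution with all atoms at most \<open>q\<close> has entropy at least
  \<open>- ln q\<close>. The alternative \<open>r = 0\<close> covers \<open>n < N\<close>, where the
  bound is trivial.\<close>

lemma entropy_lower:
  assumes "n \<ge> 1" "r = 0 \<or> (r + 1) * N \<le> n"
  shows "r * ln (card V) \<le> partition_entropy block_measure (dynamical_join block_measure shift n letter_partition)"
proof -
  have upper: "cyl_prob n w \<le> (1 / card V) ^ r" for w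
    using assms(2) cyl_prob_upper by (auto simp: cyl_prob_def)
  have "cyl_prob n w * (r * ln (card V)) \<le> - (cyl_prob n w * ln (cyl_prob n w))" for w
  proof (cases "cyl_prob n w = 0")
    case False
    then have pos: "cyl_prob n w > 0" by (simp add: cyl_prob_def less_le)
    have "ln (cyl_prob n w) \<le> ln ((1 / card V) ^ r)"
      using upper pos by (intro ln_mono) auto
    also have "\<dots> = - (r * ln (card V))" using card_V_ge_1 by (simp add: ln_realpow ln_div)
    finally show ?thesis using mult_left_mono[of "r * ln (card V)" "- ln (cyl_prob n w)" "cyl_prob n w"] pos by simp
  qed simp
  then have "(\<Sum>w\<in>prefix n ` X. cyl_prob n w * (r * ln (card V))) \<le>
      (\<Sum>w\<in>prefix n ` X. - (cyl_prob n w * ln (cyl_prob n w)))" by (intro sum_mono) auto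
  then show ?thesis
    unfolding partition_entropy_letters[OF assms(1)] sum_distrib_right[symmetric] sum_cyl_prob by simp
qed

text \<open>The dual estimate, with atoms bounded from below. Together with
  \<open>entropy_lower\<close> it establishes convergence, without which the \<open>lim\<close> in
  \<open>kolmogorov_entropy\<close> would have no known value.\<close>

lemma entropy_upper:
  assumes "n \<ge> 1" "N + n \<le> R * N"
  shows "partition_entropy block_measure (dynamical_join block_measure shift n letter_partition) \<le>
    R * ln (card V) + ln N"
proof -
  have "- (cyl_prob n w * ln (cyl_prob n w)) \<le> cyl_prob n w * (R * ln (card V) + ln N)" for w
  proof (cases "cyl_prob n w = 0")
    case False
    then have pos: "cyl_prob n w > 0" by (simp add: cyl_prob_def less_le)
    have "- (R * ln (card V) + ln N) = ln ((1 / card V) ^ R / N)"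
      using card_V_ge_1 N_pos by (simp add: ln_realpow ln_div)
    also have "\<dots> \<le> ln (cyl_prob n w)"
      using cyl_prob_lower[OF assms(2) pos] card_V_ge_1 N_pos by (intro ln_mono) auto
    finally show ?thesis
      using mult_left_mono[of "- ln (cyl_prob n w)" "R * ln (card V) + ln N" "cyl_prob n w"] pos by simp
  qed simp
  then have "(\<Sum>w\<in>prefix n ` X. - (cyl_prob n w * ln (cyl_prob n w))) \<le>
      (\<Sum>w\<in>prefix n ` X. cyl_prob n w * (R * ln (card V) + ln N))" by (intro sum_mono) auto
  then show ?thesis
    unfolding partition_entropy_letters[OF assms(1)] sum_distrib_right[symmetric] sum_cyl_prob by simp
qed

lemma entropy_rate:
  "(\<lambda>n. partition_entropy block_measure (dynamical_join block_measure shift n letter_partition) / n)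
     \<longlonglongrightarrow> ln (card V) / N" (is "(\<lambda>n. ?H n / n) \<longlonglongrightarrow> _")
proof -
  have q: "0 \<le> ln (card V)" using card_V_ge_1 by simp
  have N: "0 < real N" "0 \<le> ln N" using N_pos by auto
  \<comment> \<open>Either bound misses \<open>n / N\<close> by at most two words;
    \<open>ln N\<close> accounts for the offset.\<close>
  define K where "K = 2 * ln (card V) + ln N"
  have "norm (?H n / n - ln (card V) / N) \<le> K / n" if n: "n \<ge> 1" for n
  proof -
    have n_eq: "n = n div N * N + n mod N" "n mod N < N" using N_pos by simp_all
    have "real n = real (n div N) * real N + real (n mod N)"
      using n_eq(1) by (metis of_nat_add of_nat_mult)
    then have "real (n div N) * real N \<le> n" "n \<le> (real (n div N) + 1) * real N"
      using n_eq(2) by (simp_all add: algebra_simps)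
    then have d: "n / N - 1 \<le> real (n div N)" "real (n div N) \<le> n / N"
      using N(1) by (simp_all add: pos_le_divide_eq pos_divide_le_eq diff_le_eq)
    have "n / N - 2 \<le> real (n div N - 1)" using d(1) by linarith
    then have "(n / N - 2) * ln (card V) \<le> real (n div N - 1) * ln (card V)"
      using q by (rule mult_right_mono)
    also have "n div N - 1 = 0 \<or> (n div N - 1 + 1) * N \<le> n" 
      using div_times_less_eq_dividend[of n N] by (cases "n div N = 0") auto
    then have "real (n div N - 1) * ln (card V) \<le> ?H n" by (rule entropy_lower[OF n])
    finally have "n / N * ln (card V) - K \<le> ?H n" using N(2) by (simp add: K_def algebra_simps)
    then have lo: "(n / N * ln (card V) - K) / n \<le> ?H n / n" by (rule divide_right_mono) simp
    have "n \<le> n div N * N + N" using n_eq by linarith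
    then have "?H n \<le> real (n div N + 2) * ln (card V) + ln N"
      by (intro entropy_upper[OF n]) (simp add: algebra_simps)
    also have "\<dots> \<le> (n / N + 2) * ln (card V) + ln N"
      using d(2) q by (intro add_mono mult_right_mono) auto
    finally have "?H n \<le> n / N * ln (card V) + K" by (simp add: K_def algebra_simps)
    then have hi: "?H n / n \<le> (n / N * ln (card V) + K) / n" by (rule divide_right_mono) simp
    have "(n / N * ln (card V) - K) / n = ln (card V) / N - K / n"
      "(n / N * ln (card V) + K) / n = ln (card V) / N + K / n"
      using n by (simp_all add: field_simps)
    with lo hi show ?thesis unfolding real_norm_def abs_le_iff by linarith
  qed
  then have "eventually (\<lambda>n. norm (?H n / n - ln (card V) / N) \<le> K / n) sequentially"
    unfolding eventually_sequentially by blast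
  then have "(\<lambda>n. ?H n / n - ln (card V) / N) \<longlonglongrightarrow> 0"
    by (rule Lim_null_comparison[OF _ lim_const_over_n])
  then show ?thesis by (rule LIM_zero_cancel)
qed

lemma kolmogorov_entropy_block: "ereal (ln (card V) / N) \<le> kolmogorov_entropy block_measure shift"
  unfolding kolmogorov_entropy_def
  by (rule SUP_upper2[of letter_partition]) (use letter_partition limI[OF entropy_rate] in auto)

lemma pressure_block:
  assumes f: "f \<in> borel_measurable (restrict_space borel X)" "\<And>x. x \<in> X \<Longrightarrow> \<bar>f x\<bar> \<le> (K::real)"
    and s: "\<And>\<omega>. (\<And>i. \<omega> i \<in> V) \<Longrightarrow> s \<le> birkhoff_sum f N (concat_words N \<omega>)"
    and \<beta>: "\<beta> \<ge> 0"
  shows "ereal ((ln (card V) + \<beta> * s) / N) \<le> pressure X f \<beta>"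
proof -
  have "\<beta> * (s / N) \<le> \<beta> * (\<integral>x. f x \<partial>block_measure)"
    using integral_block_ge[OF f s] \<beta> by (rule mult_left_mono)
  then have "ereal (ln (card V) / N) + ereal (\<beta> * (s / N)) \<le>
      kolmogorov_entropy block_measure shift + ereal (\<beta> * (\<integral>x. f x \<partial>block_measure))"
    using kolmogorov_entropy_block by (intro add_mono) auto
  also have "\<dots> \<le> pressure X f \<beta>"
    unfolding pressure_def using block_measure_invariant by (rule SUP_upper)
  finally show ?thesis by (simp add: add_divide_distrib)
qed

end

section \<open>Continuity and compactness\<close>

lemma open_cylinder: "open {y :: nat \<Rightarrow> nat. prefix m y = prefix m x}"
proof -
  have "open (\<Inter>i\<in>{..<m}. (\<lambda>y :: nat \<Rightarrow> nat. y i) -` {x i})"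
    by (intro open_INT ballI open_vimage continuous_on_product_coordinates) (simp, rule Topological_Spaces.open_discrete)
  also have "(\<Inter>i\<in>{..<m}. (\<lambda>y :: nat \<Rightarrow> nat. y i) -` {x i}) = {y. prefix m y = prefix m x}"
    by (auto simp: prefix_eq_iff)
  finally show ?thesis .
qed

lemma compact_sequences: "compact {x :: nat \<Rightarrow> nat. \<forall>i. x i \<in> {1..D}}"
proof -
  have "compactin (product_topology (\<lambda>i. euclidean) UNIV) (PiE UNIV (\<lambda>i :: nat. {1..D :: nat}))"
    by (subst compactin_PiE) (auto simp: finite_imp_compact)
  moreover have "PiE UNIV (\<lambda>i :: nat. {1..D}) = {x. \<forall>i. x i \<in> {1..D}}"
    by (auto simp: PiE_def Pi_def extensional_def)
  ultimately show ?thesis by (simp add: euclidean_product_topology)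
qed

text \<open>\<open>C\<close> is compact, so finitely many of the local cylinders cover it. The sum
  of their depths serves as a common bound.\<close>

lemma uniform_cylinder_depth:
  assumes bounded: "\<And>x i. x \<in> C \<Longrightarrow> x i \<in> {1..D :: nat}"
    and closed: "\<And>x. (\<And>n. \<exists>y\<in>C. prefix n y = prefix n x) \<Longrightarrow> x \<in> C"
    and local: "\<And>x. x \<in> C \<Longrightarrow> \<exists>m. \<forall>y\<in>C. prefix m y = prefix m x \<longrightarrow> R m y"
    and mono: "\<And>m n y. R m y \<Longrightarrow> m \<le> n \<Longrightarrow> R n y"
  shows "\<exists>m. \<forall>y\<in>C. R m y"
proof -
  have "closed C"
    unfolding closed_def
  proof (subst open_subopen, intro ballI)
    fix x assume "x \<in> - C"
    then obtain n where "\<forall>y\<in>C. prefix n y \<noteq> prefix n x" using closed by blast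
    then show "\<exists>T. open T \<and> x \<in> T \<and> T \<subseteq> - C"
      using open_cylinder[of n x] by (intro exI[of _ "{y. prefix n y = prefix n x}"]) auto
  qed
  then have "compact ({x :: nat \<Rightarrow> nat. \<forall>i. x i \<in> {1..D}} \<inter> C)"
    by (rule compact_Int_closed[OF compact_sequences])
  also have "{x :: nat \<Rightarrow> nat. \<forall>i. x i \<in> {1..D}} \<inter> C = C" using bounded by blast
  finally have C: "compact C" .
  obtain m where m: "\<And>x y. x \<in> C \<Longrightarrow> y \<in> C \<Longrightarrow> prefix (m x) y = prefix (m x) x \<Longrightarrow> R (m x) y"
    using local by metis
  obtain F where F: "F \<subseteq> C" "finite F" "C \<subseteq> (\<Union>x\<in>F. {y. prefix (m x) y = prefix (m x) x})"
    by (rule compactE_image[OF C, of C "\<lambda>x. {y. prefix (m x) y = prefix (m x) x}"])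
      (auto intro: open_cylinder)
  have "R (\<Sum>x\<in>F. m x) y" if y: "y \<in> C" for y
  proof -
    obtain x where x: "x \<in> F" "prefix (m x) y = prefix (m x) x" using F(3) y by blast
    then have "R (m x) y" using m F(1) y by blast
    moreover have "m x \<le> (\<Sum>x\<in>F. m x)" using x F(2) by (intro member_le_sum) auto
    ultimately show ?thesis by (rule mono)
  qed
  then show ?thesis by blast
qed

section \<open>Topological entropy and the number of words\<close>

definition word_count :: "nat \<Rightarrow> (nat \<Rightarrow> nat) set \<Rightarrow> nat" where
  "word_count n K = card (prefix n ` K)"

lemma word_count_mono:
  assumes "finite (prefix n' ` K)" "n \<le> n'"
  shows "word_count n K \<le> word_count n' K"
proof -
  have "prefix n ` K = take n ` prefix n' ` K"
    using assms(2) by (simp add: image_image min_absorb1)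
  then show ?thesis unfolding word_count_def using assms(1) by (metis card_image_le)
qed

lemma word_count_add:
  assumes "\<And>n. finite (prefix n ` K)" "\<And>x n. x \<in> K \<Longrightarrow> suffix n x \<in> K"
  shows "word_count (n + m) K \<le> word_count n K * word_count m K"
proof -
  have "prefix (n + m) ` K \<subseteq> (\<lambda>(u, v). u @ v) ` (prefix n ` K \<times> prefix m ` K)"
  proof
    fix w assume "w \<in> prefix (n + m) ` K"
    then obtain x where "x \<in> K" "w = prefix (n + m) x" by blast
    then show "w \<in> (\<lambda>(u, v). u @ v) ` (prefix n ` K \<times> prefix m ` K)"
      using assms(2)[of x n] by (intro image_eqI[of _ _ "(prefix n x, prefix m (suffix n x))"])
        (auto simp: prefix_add_eq simp del: subsequence_shift)
  qed
  then have "word_count (n + m) K \<le> card ((\<lambda>(u, v). u @ v) ` (prefix n ` K \<times> prefix m ` K))"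
    unfolding word_count_def using assms(1) by (intro card_mono) auto
  also have "\<dots> \<le> card (prefix n ` K \<times> prefix m ` K)"
    using assms(1) by (intro card_image_le) auto
  finally show ?thesis by (simp add: word_count_def card_cartesian_product)
qed

lemma word_count_mult:
  assumes "\<And>n. finite (prefix n ` K)" "\<And>x n. x \<in> K \<Longrightarrow> suffix n x \<in> K"
  shows "word_count (q * p) K \<le> word_count p K ^ q"
proof (induction q)
  case 0
  have "prefix 0 ` K \<subseteq> {[]}" by auto
  then have "word_count 0 K \<le> card {[] :: nat list}" unfolding word_count_def by (intro card_mono) auto
  then show ?case by simp
next
  case (Suc q)
  have "word_count (Suc q * p) K \<le> word_count p K * word_count (q * p) K"
    using word_count_add[OF assms, of p "q * p"] by simp
  also have "\<dots> \<le> word_count p K * word_count p K ^ q" using Suc by (rule mult_left_mono) simp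
  finally show ?case by simp
qed

lemma separated_card_le:
  assumes "separated_set n \<epsilon> E" "E \<subseteq> K" "(1/2) ^ c \<le> \<epsilon>" "finite (prefix (n + c) ` K)"
  shows "card E \<le> word_count (n + c) K"
proof -
  have "inj_on (prefix (n + c)) E"
  proof (rule inj_onI, rule ccontr)
    fix x y assume xy: "x \<in> E" "y \<in> E" "prefix (n + c) x = prefix (n + c) y" "x \<noteq> y"
    then obtain k where k: "k < n" "seq_dist ((shift ^^ k) x) ((shift ^^ k) y) > \<epsilon>"
      using assms(1) unfolding separated_set_def by blast
    have "prefix c (suffix k x) = prefix c (suffix k y)"
      unfolding prefix_eq_iff suffix_nth using xy(3) k(1) by (simp add: prefix_eq_iff)
    then have "seq_dist (suffix k x) (suffix k y) \<le> (1/2) ^ c" by (rule seq_dist_le)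
    with k assms(3) show False by (simp add: funpow_shift)
  qed
  then have "card E = card (prefix (n + c) ` E)" by (simp add: card_image)
  also have "\<dots> \<le> word_count (n + c) K"
    unfolding word_count_def using assms(2,4) by (intro card_mono) auto
  finally show ?thesis .
qed

lemma word_count_ge_1: "K \<noteq> {} \<Longrightarrow> finite (prefix n ` K) \<Longrightarrow> 1 \<le> word_count n K"
  unfolding word_count_def by (simp add: Suc_le_eq card_gt_0_iff)

text \<open>Distinct points of a separated set differ within \<open>n + c\<close> letters. Cutting
  these letters into words of length \<open>p\<close> gives at most \<open>(n + c) / p + 1\<close>
  factors \<open>word_count p K\<close>, and both \<open>c\<close> and the extra factor disappear
  after division by \<open>n\<close>.\<close>

lemma limsup_separated_le:
  fixes K :: "(nat \<Rightarrow> nat) set"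
  assumes fin: "\<And>n. finite (prefix n ` K)" and inv: "\<And>x n. x \<in> K \<Longrightarrow> suffix n x \<in> K" and K: "K \<noteq> {}"
    and p: "p \<ge> 1" and \<epsilon>: "\<epsilon> > 0"
  shows "limsup (\<lambda>n. SUP E\<in>{E. E \<subseteq> K \<and> finite E \<and> E \<noteq> {} \<and> separated_set n \<epsilon> E}.
         ereal (ln (real (card E)) / real n)) \<le> ereal (ln (word_count p K) / p)"
proof -
  obtain c where c: "(1/2::real) ^ c < \<epsilon>" using real_arch_pow_inv[of \<epsilon> "1/2"] \<epsilon> by auto
  define l where "l = ln (real (word_count p K))"
  have l: "0 \<le> l" using word_count_ge_1[OF K fin, of p] by (simp add: l_def)
  define b where "b n = l / p + ((c / p + 1) * l) / real n" for n
  have bound: "ln (real (card E)) / real n \<le> b n"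
    if "n \<ge> 1" "E \<subseteq> K" "finite E" "E \<noteq> {}" "separated_set n \<epsilon> E" for n E
  proof -
    define q where "q = (n + c) div p + 1"
    have eq: "n + c = (n + c) div p * p + (n + c) mod p" "(n + c) mod p < p" using p by simp_all
    have "n + c \<le> q * p" using eq unfolding q_def distrib_right by linarith
    then have "word_count (n + c) K \<le> word_count (q * p) K" by (rule word_count_mono[OF fin])
    also have "\<dots> \<le> word_count p K ^ q" by (rule word_count_mult[OF fin inv])
    finally have "card E \<le> word_count p K ^ q"
      using separated_card_le[OF that(5,2) less_imp_le[OF c] fin] by simp
    then have "real (card E) \<le> real (word_count p K) ^ q" by (metis of_nat_le_iff of_nat_power)
    moreover have "0 < real (card E)" using that by (simp add: card_gt_0_iff)
    ultimately have "ln (real (card E)) \<le> ln (real (word_count p K) ^ q)" by (intro ln_mono) auto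
    also have "\<dots> = real q * l"
      using word_count_ge_1[OF K fin, of p] by (simp add: l_def ln_realpow)
    also have "\<dots> \<le> ((n + c) / p + 1) * l"
    proof (rule mult_right_mono[OF _ l])
      have "real ((n + c) div p) * p \<le> n + c"
        using div_times_less_eq_dividend[of "n + c" p] by (metis of_nat_le_iff of_nat_mult)
      then show "real q \<le> real (n + c) / p + 1" using p by (simp add: q_def pos_le_divide_eq)
    qed
    finally have "ln (real (card E)) / n \<le> (((n + c) / p + 1) * l) / n" by (rule divide_right_mono) simp
    also have "\<dots> = b n" using that(1) p by (simp add: b_def field_simps)
    finally show ?thesis .
  qed
  have "limsup (\<lambda>n. SUP E\<in>{E. E \<subseteq> K \<and> finite E \<and> E \<noteq> {} \<and> separated_set n \<epsilon> E}.
         ereal (ln (real (card E)) / real n)) \<le> limsup (\<lambda>n. ereal (b n))"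
    by (rule Limsup_mono) (auto simp: eventually_sequentially intro!: exI[of _ 1] SUP_least bound)
  also have "b \<longlonglongrightarrow> l / p + 0"
    unfolding b_def by (intro tendsto_intros lim_const_over_n)
  then have "limsup (\<lambda>n. ereal (b n)) = ereal (l / p)"
    by (intro lim_imp_Limsup) (auto simp: tendsto_ereal)
  finally show ?thesis by (simp add: l_def)
qed

text \<open>One direction of Fekete's lemma: by submultiplicativity the growth rate is at most
  \<open>ln (word_count p K) / p\<close> for each single \<open>p\<close>, so the count holds at
  every length and not only asymptotically.\<close>

lemma topological_entropy_word_count:
  fixes K :: "(nat \<Rightarrow> nat) set"
  assumes fin: "\<And>n. finite (prefix n ` K)" and inv: "\<And>x n. x \<in> K \<Longrightarrow> suffix n x \<in> K" and K: "K \<noteq> {}"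
  obtains h where "topological_entropy K = ereal h" "0 \<le> h" "\<And>p. exp (h * real p) \<le> word_count p K"
proof -
  define f where "f \<epsilon> = limsup (\<lambda>n. SUP E\<in>{E. E \<subseteq> K \<and> finite E \<and> E \<noteq> {} \<and> separated_set n \<epsilon> E}.
         ereal (ln (real (card E)) / real n))" for \<epsilon> :: real
  have "(f \<longlongrightarrow> (SUP e\<in>{0<..}. f e)) (at_right 0)"
  proof (rule Lim_at_right_increasing)
    fix e e' :: real assume "0 < e" "e \<le> e'"
    then have "separated_set n e' E \<Longrightarrow> separated_set n e E" for n E
      unfolding separated_set_def by (meson le_less_trans)
    then show "f e' \<le> f e"
      unfolding f_def by (intro Limsup_mono always_eventually allI SUP_subset_mono) auto
  qed
  then have top: "topological_entropy K = (SUP e\<in>{0<..}. f e)"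
    unfolding topological_entropy_def f_def by (intro tendsto_Lim) simp
  have up: "topological_entropy K \<le> ereal (ln (word_count p K) / p)" if "p \<ge> 1" for p
    unfolding top f_def using limsup_separated_le[OF fin inv K that] by (intro SUP_least) auto
  obtain x where x: "x \<in> K" using K by blast
  \<comment> \<open>A singleton is separated at every scale; with the upper bound for
    \<open>p = 1\<close> this makes the entropy a real number.\<close>
  have "(0::ereal) = limsup (\<lambda>n. 0)" by (simp add: Limsup_const)
  also have "\<dots> \<le> f 1" unfolding f_def
    by (intro Limsup_mono always_eventually allI SUP_upper2[of "{x}"])
      (use x in \<open>auto simp: separated_set_def zero_ereal_def\<close>)
  also have "f 1 \<le> topological_entropy K" unfolding top by (rule SUP_upper) simp
  finally have low: "0 \<le> topological_entropy K" .
  obtain h where h: "topological_entropy K = ereal h" "0 \<le> h"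
    using low up[of 1] by (cases "topological_entropy K") auto
  have "exp (h * real p) \<le> word_count p K" for p
  proof (cases "p = 0")
    case True
    then show ?thesis using word_count_ge_1[OF K fin, of 0] by simp
  next
    case False
    then have "h \<le> ln (word_count p K) / p" using up[of p] h by simp
    then have "h * p \<le> ln (word_count p K)" using False by (simp add: pos_le_divide_eq)
    then have "exp (h * p) \<le> exp (ln (word_count p K))" by simp
    also have "\<dots> = word_count p K" using word_count_ge_1[OF K fin, of p] by (intro exp_ln) simp
    finally show ?thesis .
  qed
  with h show thesis by (rule that)
qed

section \<open>Continuity and boundedness of the potential\<close>

context sft_potential
begin

lemma A_continuous: "continuous_on X A"
  unfolding continuous_on_topological
proof (intro ballI allI impI)
  fix x B assume x: "x \<in> X" and B: "open B" "A x \<in> B"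
  then obtain e where e: "e > 0" "ball (A x) e \<subseteq> B" using open_contains_ball by blast
  then obtain m where m: "L * (1/2) ^ m < e" using exists_small by blast
  have "A y \<in> B" if "y \<in> X" "prefix m y = prefix m x" for y
    using lip_prefix[OF that(1) x that(2)] m e(2) by (auto simp: dist_real_def)
  then show "\<exists>S. open S \<and> x \<in> S \<and> (\<forall>y\<in>X. y \<in> S \<longrightarrow> A y \<in> B)"
    using open_cylinder[of m x] by (intro exI[of _ "{y. prefix m y = prefix m x}"]) auto
qed

lemma A_measurable: "A \<in> borel_measurable (restrict_space borel X)"
  by (rule borel_measurable_continuous_on_restrict[OF A_continuous])

lemma A_bounded: "\<exists>K. \<forall>x\<in>X. \<bar>A x\<bar> \<le> K"
proof (cases "X = {}")
  case False
  then obtain x0 where x0: "x0 \<in> X" by blast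
  have "\<bar>A x\<bar> \<le> \<bar>A x0\<bar> + L" if "x \<in> X" for x
    using lip_prefix[OF that x0, of 0] by simp
  then show ?thesis by blast
qed simp

lemma finite_prefix_X: "K \<subseteq> X \<Longrightarrow> finite (prefix n ` K)"
proof (rule finite_subset)
  assume "K \<subseteq> X"
  then show "prefix n ` K \<subseteq> {w. set w \<subseteq> {1..D} \<and> length w = n}" by (auto dest!: subsetD simp: X_iff)
qed (simp add: finite_lists_length_eq)

section \<open>Transition words between components\<close>

text \<open>A word of length \<open>Suc m\<close> that is missing from \<open>C\<close> will mark the beginning of each visit to \<open>C\<close>;
  this is what makes chains decodable.\<close>

lemma exit_depth:
  assumes C: "C \<in> irreducible_components X A" and C': "C' \<in> irreducible_components X A"
    and s: "ereal s < S_ext X A C' C" and e: "e > 0"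
  shows "\<exists>m. \<forall>x\<in>C. \<exists>z\<in>X. suffix 1 z = x \<and> prefix (Suc m) z \<notin> prefix (Suc m) ` C \<and>
    (\<forall>y\<in>C'. connects 1 y z (s - 2 * e - A z))"
proof (rule uniform_cylinder_depth[of C D])
  show "\<And>x i. x \<in> C \<Longrightarrow> x i \<in> {1..D}" using component_subset_X[OF C] X_iff by blast
  show "\<And>x. (\<And>n. \<exists>y\<in>C. prefix n y = prefix n x) \<Longrightarrow> x \<in> C"
    by (rule component_closed[OF C])
  have deeper: "prefix (Suc n) z \<notin> prefix (Suc n) ` C"
    if "prefix m z \<notin> prefix m ` C" "m \<le> Suc n" for m n z
  proof
    assume "prefix (Suc n) z \<in> prefix (Suc n) ` C"
    then obtain y where "y \<in> C" "prefix (Suc n) z = prefix (Suc n) y" by blast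
    then have "prefix m z = prefix m y" "y \<in> C" using prefix_eq_mono that(2) by blast+
    with that(1) show False by blast
  qed
  show "\<exists>z\<in>X. suffix 1 z = y \<and> prefix (Suc n) z \<notin> prefix (Suc n) ` C \<and>
        (\<forall>y\<in>C'. connects 1 y z (s - 2 * e - A z))"
    if "\<exists>z\<in>X. suffix 1 z = y \<and> prefix (Suc m) z \<notin> prefix (Suc m) ` C \<and>
        (\<forall>y\<in>C'. connects 1 y z (s - 2 * e - A z))" "m \<le> n" for m n y
    using that deeper[where m = "Suc m" and n = n] by fastforce
  show "\<exists>m. \<forall>x'\<in>C. prefix m x' = prefix m x \<longrightarrow>
      (\<exists>z\<in>X. suffix 1 z = x' \<and> prefix (Suc m) z \<notin> prefix (Suc m) ` C \<and>
        (\<forall>y\<in>C'. connects 1 y z (s - 2 * e - A z)))" if x: "x \<in> C" for x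
  proof -
    have "ereal s < Sup {mane_potential X A y z + ereal (A z) | y z.
        z \<in> X \<and> shift z = x \<and> z \<notin> C \<and> y \<in> C'}"
      using s x unfolding S_ext_def by (rule less_INF_D)
    then obtain y0 z where z: "z \<in> X" "shift z = x" "z \<notin> C" "y0 \<in> C'"
      "ereal s < mane_potential X A y0 z + ereal (A z)" by (auto simp: less_Sup_iff)
    have "ereal (s - A z) \<le> mane_potential X A y0 z"
      using z(5) by (cases "mane_potential X A y0 z") auto
    then have y0: "connects 1 y0 z (s - A z)" by (simp add: mane_ge_iff)
    \<comment> \<open>Points of \<open>C'\<close> reach each other at zero cost, so the bound does
      not depend on the starting point.\<close>
    have yz: "connects 1 y z (s - A z)" if "y \<in> C'" for y
      using connects_weaken[OF connects_trans[OF component_connects[OF C' that z(4)] y0], of "s - A z" 1]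
      by simp
    obtain n where n: "\<forall>y\<in>C. prefix n y \<noteq> prefix n z" using component_closed[OF C] z(3) by blast
    obtain me where me: "\<And>m. m \<ge> me \<Longrightarrow> L * (1/2) ^ m < e" using exists_small[OF e] by blast
    define m1 where "m1 = n + me"
    define m where "m = Suc m1"
    have sz: "suffix 1 z = x" using z(2) by (simp add: shift_eq_suffix)
    show ?thesis
    proof (intro exI[of _ m] ballI impI)
      fix x' assume x': "x' \<in> C" "prefix m x' = prefix m x"
      have x'X: "x' \<in> X" using x' component_subset_X[OF C] by blast
      \<comment> \<open>The preimage of a nearby point \<open>x'\<close> borrows the letter of
        \<open>z\<close>. It stays close to \<open>z\<close>, hence in a cylinder that misses the
        closed set \<open>C\<close>.\<close>
      define z' where "z' = prefix 1 z \<frown> x'"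
      have z': "z' \<in> X" "prefix (1 + m) z' = prefix (1 + m) z"
        using conc_prefix[OF z(1) x'X, of m1 1] x'(2) unfolding sz by (simp_all add: z'_def m_def)
      have m_small: "L * (1/2) ^ m < e" "L * (1/2) ^ (1 + m) < e"
        using me by (simp_all add: m_def m1_def del: power_Suc)
      have "\<bar>A z' - A z\<bar> \<le> L * (1/2) ^ (1 + m)" by (rule lip_prefix[OF z'(1) z(1) z'(2)])
      then have Az: "\<bar>A z' - A z\<bar> < e" using m_small by linarith
      have cz: "connects 1 y z' (s - A z - L * (1/2) ^ m)" if y: "y \<in> C'" for y
        using component_connects[OF C' y y] yz[OF y] z(1) z'
        by (intro connects_move_right[where y = z]) auto
      \<comment> \<open>One \<open>e\<close> pays for moving the end point from \<open>z\<close> to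
        \<open>z'\<close>, the other for replacing \<open>A z\<close> by
        \<open>A z'\<close>.\<close>
      have "connects 1 y z' (s - 2 * e - A z')" if y: "y \<in> C'" for y
        by (rule connects_weaken[OF cz[OF y]]) (use Az m_small(1) in linarith, simp)
      moreover have "suffix 1 z' = x'" by (simp add: z'_def)
      moreover have "prefix n z' \<notin> prefix n ` C"
      proof -
        have "prefix n z' = prefix n z" using z'(2) by (rule prefix_eq_mono) (simp add: m_def m1_def)
        then show ?thesis using n by fastforce
      qed
      then have "prefix (Suc m) z' \<notin> prefix (Suc m) ` C" by (rule deeper) (simp add: m_def m1_def)
      ultimately show "\<exists>z\<in>X. suffix 1 z = x' \<and> prefix (Suc m) z \<notin> prefix (Suc m) ` C \<and>
        (\<forall>y\<in>C'. connects 1 y z (s - 2 * e - A z))" using z'(1) by blast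
    qed
  qed
qed

text \<open>Since the exit depth is uniform over \<open>C\<close>, one threshold \<open>m0\<close>
  serves all pairs of points. From there on only the overlaps of \<open>x\<close> and
  \<open>y\<close> matter, so finitely many words \<open>u\<close> suffice for each
  \<open>m\<close>.\<close>

lemma transition_word:
  assumes C: "C \<in> irreducible_components X A" and C': "C' \<in> irreducible_components X A"
    and s: "ereal s < S_ext X A C' C"
  obtains m0 where "\<And>m x y. m \<ge> m0 \<Longrightarrow> x \<in> C \<Longrightarrow> y \<in> C' \<Longrightarrow>
    \<exists>u. u \<noteq> [] \<and> last u # prefix m x \<notin> prefix (Suc m) ` C \<and>
      (\<forall>x'\<in>X. prefix m x' = prefix m x \<longrightarrow> u \<frown> x' \<in> X \<and> prefix m (u \<frown> x') = prefix m y \<and>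
        s \<le> birkhoff_sum A (length u) (u \<frown> x'))"
proof -
  obtain s' where s': "s < s'" "ereal s' < S_ext X A C' C" using ereal_dense2[OF s] by auto
  \<comment> \<open>Two parts are spent in \<open>exit_depth\<close>, one on choosing the path
    \<open>z2\<close>, and one on replacing \<open>x\<close> by \<open>x'\<close>.\<close>
  define e where "e = (s' - s) / 4"
  have e: "e > 0" using s' by (simp add: e_def)
  obtain m1 where m1: "\<And>x. x \<in> C \<Longrightarrow> \<exists>z\<in>X. suffix 1 z = x \<and> prefix (Suc m1) z \<notin> prefix (Suc m1) ` C \<and>
    (\<forall>y\<in>C'. connects 1 y z (s' - 2 * e - A z))" using exit_depth[OF C C' s'(2) e] by blast
  obtain me where me: "\<And>m. m \<ge> me \<Longrightarrow> L * (1/2) ^ m < e" using exists_small[OF e] by blast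
  show thesis
  proof (rule that[of "Suc (m1 + me)"])
    fix m x y assume m: "m \<ge> Suc (m1 + me)" and x: "x \<in> C" and y: "y \<in> C'"
    obtain k where k: "m = Suc k" "me \<le> k" "m1 \<le> k" using m by (cases m) auto
    obtain z where z: "z \<in> X" "suffix 1 z = x" "prefix (Suc m1) z \<notin> prefix (Suc m1) ` C"
      "connects 1 y z (s' - 2 * e - A z)" using m1[OF x] y by blast
    obtain n z2 where z2: "z2 \<in> X" "suffix n z2 = z" "prefix m z2 = prefix m y"
      "birkhoff_sum A n z2 > s' - 2 * e - A z - e"
      using z(4) e unfolding connects_def by blast
    \<comment> \<open>The additional letter is that of \<open>z\<close>, the preimage outside
      \<open>C\<close>; as the last letter of \<open>u\<close> it is the marker read in
      decoding.\<close>
    define u where "u = prefix (n + 1) z2"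
    have len: "length u = n + 1" by (simp add: u_def)
    have suf: "suffix (n + 1) z2 = x" using z(2) z2(2) by (metis suffix_suffix add.commute)
    have "z 0 = z2 n" using z2(2) by auto
    then have "last u = z 0" by (simp add: u_def)
    then have "last u # prefix m x = prefix (Suc m) z"
      using prefix_add_eq[where n = 1 and m = m and x = z] z(2) by (simp add: subsequence_def)
    moreover have "prefix (Suc m) z \<notin> prefix (Suc m) ` C"
    proof
      assume "prefix (Suc m) z \<in> prefix (Suc m) ` C"
      then obtain w where w: "w \<in> C" "prefix (Suc m) z = prefix (Suc m) w" by blast
      have "prefix (Suc m1) z = prefix (Suc m1) w"
        by (rule prefix_eq_mono[OF w(2)]) (use m in simp)
      with z(3) w(1) show False by blast
    qed
    moreover have "u \<frown> x' \<in> X \<and> prefix m (u \<frown> x') = prefix m y \<and> s \<le> birkhoff_sum A (length u) (u \<frown> x')"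
      if x': "x' \<in> X" "prefix m x' = prefix m x" for x'
    proof -
      have *: "u \<frown> x' \<in> X" "prefix (n + 1 + m) (u \<frown> x') = prefix (n + 1 + m) z2"
        using conc_prefix[OF z2(1) x'(1), of k "n + 1", unfolded suf] x'(2) unfolding u_def k(1) by blast+
      have "prefix m (u \<frown> x') = prefix m z2" using *(2) by (rule prefix_eq_mono) simp
      moreover have "\<bar>birkhoff_sum A (n + 1) (u \<frown> x') - birkhoff_sum A (n + 1) z2\<bar> \<le> L * (1/2) ^ m"
        by (rule birkhoff_lip[OF *(1) z2(1) *(2)])
      moreover have "L * (1/2) ^ m < e" using me m by simp
      moreover have "birkhoff_sum A (n + 1) z2 = birkhoff_sum A n z2 + A z"
        unfolding birkhoff_sum_add z2(2) birkhoff_sum_1 ..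
      moreover have "s = s' - 4 * e" by (simp add: e_def field_simps)
      ultimately show ?thesis using *(1) z2(3,4) unfolding len by (intro conjI) (simp, simp, linarith)
    qed
    ultimately show "\<exists>u. u \<noteq> [] \<and> last u # prefix m x \<notin> prefix (Suc m) ` C \<and>
      (\<forall>x'\<in>X. prefix m x' = prefix m x \<longrightarrow> u \<frown> x' \<in> X \<and> prefix m (u \<frown> x') = prefix m y \<and>
        s \<le> birkhoff_sum A (length u) (u \<frown> x'))"
      using len by (intro exI[of _ u]) auto
  qed
qed

end

section \<open>Chains of words\<close>

lemma append_eq_cases:
  assumes "v @ w = v' @ w'"
  obtains "v = v'" "w = w'" | us where "us \<noteq> []" "v = v' @ us" "w' = us @ w"
    | us where "us \<noteq> []" "v' = v @ us" "w = us @ w'"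
proof -
  from assms obtain us where "v = v' @ us \<and> us @ w = w' \<or> v @ us = v' \<and> w = us @ w'"
    unfolding append_eq_append_conv2 by blast
  then show thesis using that by (cases "us = []") auto
qed

text \<open>Chains are built from right to left: the type \<open>t\<close> describes what follows a chain on its
  right, and each link \<open>w @ u t\<close> leads to the next type.\<close>

locale word_chain = sft_potential +
  fixes m k Lm :: nat and a u :: "nat \<Rightarrow> nat list" and W :: "nat \<Rightarrow> nat list set" and s :: "nat \<Rightarrow> real"
  assumes u_nonempty: "u t \<noteq> []"
    and W_finite: "finite (W t)"
    and link: "\<xi> \<in> X \<Longrightarrow> prefix m \<xi> = a t \<Longrightarrow> w \<in> W (Suc t) \<Longrightarrow>
      (w @ u t) \<frown> \<xi> \<in> X \<and> prefix m ((w @ u t) \<frown> \<xi>) = a (Suc t) \<and>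
      s t \<le> birkhoff_sum A (length (w @ u t)) ((w @ u t) \<frown> \<xi>)"
    and decode: "w \<in> W (Suc t) \<Longrightarrow> w' \<in> W (Suc t) \<Longrightarrow> w' \<noteq> v @ last (u (Suc t)) # w"
    and link_length: "w \<in> W (Suc t) \<Longrightarrow> length (w @ u t) \<le> Lm"
    and k_pos: "k \<ge> 1"
    and periodic: "a (t + k) = a t" "u (t + k) = u t" "W (t + k) = W t" "s (t + k) = s t"
    and base: "\<exists>\<xi>\<in>X. prefix m \<xi> = a 0"
begin

primrec chain :: "nat \<Rightarrow> nat \<Rightarrow> nat list set" where
  "chain 0 t = {[]}"
| "chain (Suc R) t = (\<lambda>(v, w). v @ w @ u t) ` (chain R (Suc t) \<times> W (Suc t))"

lemma chain_finite: "finite (chain R t)"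
  by (induction R arbitrary: t) (auto simp: W_finite)

lemma chain_last:
  assumes "v \<in> chain R t" "R > 0"
  shows "v \<noteq> []" "last v = last (u t)"
  using assms u_nonempty by (cases R; auto)+

text \<open>If two decompositions differed, the longer of the two component words would end with the
  last letter of \<open>u (Suc t)\<close> followed by the shorter one, which \<open>decode\<close>
  excludes.\<close>

lemma chain_inj: "inj_on (\<lambda>(v, w). v @ w @ u t) (chain R (Suc t) \<times> W (Suc t))"
proof -
  have no: False if "us \<noteq> []" "v' @ us \<in> chain R (Suc t)" "us @ w \<in> W (Suc t)" "w \<in> W (Suc t)" for us v' w
  proof -
    have "R > 0" using that(1,2) by (cases R) auto
    then have "last us = last (u (Suc t))" using chain_last[OF that(2)] that(1) by simp
    then have "us @ w = butlast us @ last (u (Suc t)) # w"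
      using that(1) by (metis append.assoc append_Cons append_Nil append_butlast_last_id)
    with decode[OF that(4,3)] show False by blast
  qed
  show ?thesis
  proof (rule inj_onI)
    fix p p' assume p: "p \<in> chain R (Suc t) \<times> W (Suc t)" "p' \<in> chain R (Suc t) \<times> W (Suc t)"
      and eq: "(\<lambda>(v, w). v @ w @ u t) p = (\<lambda>(v, w). v @ w @ u t) p'"
    obtain v w v' w' where vw: "p = (v, w)" "p' = (v', w')" by fastforce
    have "v @ w = v' @ w'" using eq unfolding vw by simp
    then show "p = p'"
    proof (cases rule: append_eq_cases)
      case 1
      then show ?thesis using vw by simp
    next
      case (2 us)
      then show ?thesis using no[of us v' w] p vw by simp
    next
      case (3 us)
      then show ?thesis using no[of us v w'] p vw by simp
    qed
  qed
qed

lemma chain_sum: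
  "(\<Sum>v\<in>chain R t. exp (- (p * real (length v)))) =
   (\<Prod>i<R. (\<Sum>w\<in>W (Suc (t + i)). exp (- (p * real (length w)))) * exp (- (p * real (length (u (t + i))))))"
proof (induction R arbitrary: t)
  case (Suc R)
  have "(\<Sum>v\<in>chain (Suc R) t. exp (- (p * real (length v)))) =
      (\<Sum>(v, w)\<in>chain R (Suc t) \<times> W (Suc t). exp (- (p * real (length v))) *
        (exp (- (p * real (length w))) * exp (- (p * real (length (u t))))))"
    unfolding chain.simps(2) sum.reindex[OF chain_inj]
    by (intro sum.cong) (auto simp: algebra_simps simp flip: exp_add)
  also have "\<dots> = (\<Sum>v\<in>chain R (Suc t). exp (- (p * real (length v)))) *
      ((\<Sum>w\<in>W (Suc t). exp (- (p * real (length w)))) * exp (- (p * real (length (u t)))))"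
    unfolding sum.cartesian_product[symmetric] sum_distrib_left[symmetric] sum_distrib_right[symmetric] ..
  also have "\<dots> = (\<Prod>i<Suc R. (\<Sum>w\<in>W (Suc (t + i)). exp (- (p * real (length w)))) *
      exp (- (p * real (length (u (t + i))))))"
    unfolding Suc.IH prod.lessThan_Suc_shift by (simp add: mult.commute)
  finally show ?case .
qed simp

lemma chain_step:
  assumes "v \<in> chain R t" "\<xi> \<in> X" "prefix m \<xi> = a t"
  shows "v \<frown> \<xi> \<in> X \<and> prefix m (v \<frown> \<xi>) = a (t + R) \<and> (\<Sum>i<R. s (t + i)) \<le> birkhoff_sum A (length v) (v \<frown> \<xi>)"
  using assms
proof (induction R arbitrary: v t \<xi>)
  case 0
  then show ?case by (simp add: birkhoff_sum_suffix)
next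
  case (Suc R)
  then obtain v' w where v: "v = v' @ w @ u t" "v' \<in> chain R (Suc t)" "w \<in> W (Suc t)" by auto
  define \<xi>' where "\<xi>' = (w @ u t) \<frown> \<xi>"
  have \<xi>': "\<xi>' \<in> X" "prefix m \<xi>' = a (Suc t)" "s t \<le> birkhoff_sum A (length (w @ u t)) \<xi>'"
    using link[OF Suc.prems(2,3) v(3)] unfolding \<xi>'_def by blast+
  have IH: "v' \<frown> \<xi>' \<in> X" "prefix m (v' \<frown> \<xi>') = a (Suc t + R)"
    "(\<Sum>i<R. s (Suc t + i)) \<le> birkhoff_sum A (length v') (v' \<frown> \<xi>')"
    using Suc.IH[OF v(2) \<xi>'(1,2)] by blast+
  have eq: "v \<frown> \<xi> = v' \<frown> \<xi>'" by (simp add: v(1) \<xi>'_def)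
  have "birkhoff_sum A (length v) (v' \<frown> \<xi>') =
      birkhoff_sum A (length v') (v' \<frown> \<xi>') + birkhoff_sum A (length (w @ u t)) \<xi>'"
    using birkhoff_sum_add[of A "length v'" "length (w @ u t)" "v' \<frown> \<xi>'"]
    unfolding suffix_conc_length by (simp add: v(1))
  moreover have "(\<Sum>i<Suc R. s (t + i)) = s t + (\<Sum>i<R. s (Suc t + i))"
    by (subst sum.lessThan_Suc_shift) simp
  ultimately show ?case unfolding eq using IH \<xi>'(3) by simp
qed

lemma chain_length:
  assumes "v \<in> chain R t"
  shows "R \<le> length v" "length v \<le> R * Lm"
proof -
  have "R \<le> length v \<and> length v \<le> R * Lm" using assms
  proof (induction R arbitrary: v t)
    case (Suc R)
    then obtain v' w where v: "v = v' @ w @ u t" "v' \<in> chain R (Suc t)" "w \<in> W (Suc t)" by auto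
    have "1 \<le> length (u t)" using u_nonempty[of t] by (simp add: Suc_le_eq)
    then show ?case using Suc.IH[OF v(2)] link_length[OF v(3)] v(1) by auto
  qed simp
  then show "R \<le> length v" "length v \<le> R * Lm" by blast+
qed

lemma periodic_mult: "a (r * k) = a 0"
proof (induction r)
  case (Suc r)
  then show ?case using periodic(1)[of "r * k"] by (simp add: add.commute)
qed simp

lemma concat_chain:
  assumes V: "V \<subseteq> chain (r * k) 0" "\<And>v. v \<in> V \<Longrightarrow> length v = N" and N: "N \<ge> 1" and \<omega>: "\<And>i. \<omega> i \<in> V"
  shows "concat_words N \<omega> \<in> X" "prefix m (concat_words N \<omega>) = a 0"
proof -
  \<comment> \<open>A whole number of turns expects the overlap \<open>a 0\<close> on its right and
    shows \<open>a 0\<close> on its left, so chains can be stacked. Only finitely many can be put in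
    front of a point at a time; closedness of \<open>X\<close> yields the infinite
    concatenation.\<close>
  have approx: "\<exists>\<xi>\<in>X. prefix m \<xi> = a 0 \<and> prefix (n * N) \<xi> = prefix (n * N) (concat_words N \<omega>)"
    if "\<And>i. \<omega> i \<in> V" for n \<omega>
    using that
  proof (induction n arbitrary: \<omega>)
    case 0
    then show ?case using base by simp
  next
    case (Suc n)
    have "\<And>i. suffix 1 \<omega> i \<in> V" using Suc.prems by simp
    then obtain \<xi> where \<xi>: "\<xi> \<in> X" "prefix m \<xi> = a 0"
      "prefix (n * N) \<xi> = prefix (n * N) (concat_words N (suffix 1 \<omega>))" using Suc.IH by blast
    have \<omega>0: "\<omega> 0 \<in> chain (r * k) 0" "length (\<omega> 0) = N" using Suc.prems V by auto
    have "\<omega> 0 \<frown> \<xi> \<in> X" "prefix m (\<omega> 0 \<frown> \<xi>) = a 0"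
      using chain_step[OF \<omega>0(1) \<xi>(1,2)] periodic_mult by auto
    moreover have "prefix (Suc n * N) (\<omega> 0 \<frown> \<xi>) = prefix (Suc n * N) (concat_words N \<omega>)"
      using \<xi>(3) unfolding concat_words_unroll[of N \<omega>, OF N \<omega>0(2)] by (simp add: \<omega>0(2))
    ultimately show ?case by blast
  qed
  show "concat_words N \<omega> \<in> X"
  proof (rule X_closed)
    fix n
    obtain \<xi> where "\<xi> \<in> X" "prefix (n * N) \<xi> = prefix (n * N) (concat_words N \<omega>)"
      using approx[of \<omega>, OF \<omega>] by blast
    then show "\<exists>y\<in>X. prefix n y = prefix n (concat_words N \<omega>)"
      using prefix_eq_mono[where n = "n * N" and k = n] N by (intro bexI[of _ \<xi>]) auto
  qed
  obtain \<xi> where "prefix m \<xi> = a 0" "prefix (m * N) \<xi> = prefix (m * N) (concat_words N \<omega>)"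
    using approx[of \<omega> m, OF \<omega>] by blast
  then show "prefix m (concat_words N \<omega>) = a 0"
    using prefix_eq_mono[where n = "m * N" and k = m and x = \<xi>] N by auto
qed

section \<open>Pressure from chains of words\<close>

lemma pressure_words:
  assumes V: "V \<subseteq> chain (r * k) 0" "\<And>v. v \<in> V \<Longrightarrow> length v = N" "V \<noteq> {}" and N: "N \<ge> 1" and \<beta>: "\<beta> \<ge> 0"
  shows "ereal ((ln (card V) + \<beta> * (\<Sum>i<r * k. s i)) / N) \<le> pressure X A \<beta>"
proof -
  interpret block_code X D N V
  proof
    show "finite V" using V(1) chain_finite finite_subset by blast
    show "\<And>\<omega>. (\<And>i. \<omega> i \<in> V) \<Longrightarrow> concat_words N \<omega> \<in> X"
      using concat_chain(1)[OF V(1,2) N] by blast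
  qed (use V N X_iff suffix_in_X in auto)
  obtain K where K: "\<And>x. x \<in> X \<Longrightarrow> \<bar>A x\<bar> \<le> K" using A_bounded by blast
  show ?thesis
  proof (rule pressure_block[OF A_measurable K _ \<beta>])
    fix \<omega> :: "nat \<Rightarrow> nat list" assume \<omega>: "\<And>i. \<omega> i \<in> V"
    then have \<omega>0: "\<omega> 0 \<in> chain (r * k) 0" "length (\<omega> 0) = N" using V by auto
    have "\<And>i. suffix 1 \<omega> i \<in> V" using \<omega> by simp
    note concat_chain[of V r N "suffix 1 \<omega>", OF V(1,2) N this]
    then show "(\<Sum>i<r * k. s i) \<le> birkhoff_sum A N (concat_words N \<omega>)"
      using chain_step[OF \<omega>0(1), of "concat_words N (suffix 1 \<omega>)"]
      unfolding concat_words_unroll[of N \<omega>, OF N \<omega>0(2)] by (simp add: \<omega>0(2))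
  qed
qed

text \<open>The factor of one link in the generating function of the chains, with the potential
  included. A product of 1 over a turn is the characteristic equation for the exponential growth
  rate \<open>p\<close> of the weighted chains; a product of at least 1 puts \<open>p\<close> below
  the pressure.\<close>

definition link_weight :: "real \<Rightarrow> real \<Rightarrow> nat \<Rightarrow> real" where
  "link_weight \<beta> p t = exp (\<beta> * s t) *
    ((\<Sum>w\<in>W (Suc t). exp (- (p * real (length w)))) * exp (- (p * real (length (u t)))))"

lemma link_weight_periodic: "link_weight \<beta> p (t + k) = link_weight \<beta> p t"
  using periodic[of t] periodic[of "Suc t"] by (simp add: link_weight_def)

lemma prod_link_weight: "(\<Prod>i<r * k. link_weight \<beta> p i) = (\<Prod>i<k. link_weight \<beta> p i) ^ r"
proof (induction r)
  case (Suc r)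
  have shift: "link_weight \<beta> p (i + r * k) = link_weight \<beta> p i" for i
  proof (induction r)
    case (Suc r)
    then show ?case using link_weight_periodic[of \<beta> p "i + r * k"] by (simp add: ac_simps)
  qed simp
  have split: "(\<Prod>i<n + j. f i) = (\<Prod>i<n. f i) * (\<Prod>i<j. f (i + n))" for f :: "nat \<Rightarrow> real" and n j
    by (induction j) (simp_all add: mult.assoc add.commute)
  have "(\<Prod>i<r * k + k. link_weight \<beta> p i) =
      (\<Prod>i<r * k. link_weight \<beta> p i) * (\<Prod>i<k. link_weight \<beta> p (i + r * k))"
    by (rule split)
  also have "\<dots> = (\<Prod>i<k. link_weight \<beta> p i) ^ Suc r" unfolding shift Suc by simp
  finally show ?case by (simp add: add.commute)
qed simp

text \<open>As in the Kraft--McMillan inequality, the linearly many possible lengths of a chain do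
  not matter in the limit of many links.\<close>

lemma pressure_chain_approx:
  assumes \<beta>: "\<beta> \<ge> 0" and ge: "1 \<le> (\<Prod>i<k. link_weight \<beta> p i)" and r: "r \<ge> 1"
  shows "ereal (p - ln (real (r * k * Lm + 1)) / real (r * k)) \<le> pressure X A \<beta>"
proof -
  define R where "R = r * k"
  define S where "S = (\<Sum>i<R. s i)"
  define B where "B = real (R * Lm + 1)"
  have R: "R \<ge> 1" using r k_pos by (simp add: R_def)
  have B: "B \<ge> 1" by (simp add: B_def)
  have "1 \<le> (\<Prod>i<k. link_weight \<beta> p i) ^ r" using ge by (rule one_le_power)
  also have "\<dots> = (\<Prod>i<R. link_weight \<beta> p i)" by (simp add: R_def prod_link_weight)
  also have "\<dots> = exp (\<beta> * S) * (\<Sum>v\<in>chain R 0. exp (- (p * real (length v))))"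
    unfolding link_weight_def prod.distrib chain_sum S_def sum_distrib_left exp_sum[OF finite_lessThan]
    by simp
  also have "(\<Sum>v\<in>chain R 0. exp (- (p * real (length v)))) =
      (\<Sum>N\<in>{..R * Lm}. \<Sum>v\<in>{v\<in>chain R 0. length v = N}. exp (- (p * real (length v))))"
    using chain_length(2) by (intro sum.group[symmetric] chain_finite) auto
  also have "\<dots> = (\<Sum>N\<in>{..R * Lm}. card {v\<in>chain R 0. length v = N} * exp (- (p * real N)))"
    by (intro sum.cong) simp_all
  finally have total: "1 \<le> exp (\<beta> * S) * (\<Sum>N\<in>{..R * Lm}. card {v\<in>chain R 0. length v = N} * exp (- (p * real N)))" .
  \<comment> \<open>There are \<open>B\<close> possible lengths, so one of them carries at least the
    fraction \<open>1 / B\<close> of the total weight.\<close>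
  obtain N where N: "1 \<le> B * (exp (\<beta> * S) * (card {v\<in>chain R 0. length v = N} * exp (- (p * real N))))"
  proof (rule ccontr)
    assume "\<not> thesis"
    then have "B * (exp (\<beta> * S) * (card {v\<in>chain R 0. length v = N} * exp (- (p * real N)))) < 1" for N
      using that[of N] by (meson not_le)
    then have "exp (\<beta> * S) * (card {v\<in>chain R 0. length v = N} * exp (- (p * real N))) < 1 / B" for N
      using B by (simp add: pos_less_divide_eq mult.commute)
    then have "(\<Sum>N\<in>{..R * Lm}. exp (\<beta> * S) * (card {v\<in>chain R 0. length v = N} * exp (- (p * real N))))
       < (\<Sum>N\<in>{..R * Lm}. 1 / B)" by (intro sum_strict_mono) auto
    also have "\<dots> = B * (1 / B)" unfolding B_def by simp
    also have "\<dots> = 1" using B by simp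
    finally show False using total by (simp add: sum_distrib_left)
  qed
  define V where "V = {v\<in>chain R 0. length v = N}"
  have "V \<noteq> {}"
  proof
    assume "V = {}"
    then show False using N unfolding V_def[symmetric] by simp
  qed
  \<comment> \<open>Every link has a non-empty transition word; hence the loss \<open>ln B\<close>
    is spread over at least \<open>R\<close> letters.\<close>
  then have "R \<le> N" using chain_length(1) by (auto simp: V_def)
  have "0 < card V" using \<open>V \<noteq> {}\<close> chain_finite[of R 0] by (simp add: V_def card_gt_0_iff)
  then have "0 \<le> ln (B * (exp (\<beta> * S) * (card V * exp (- (p * real N)))))" using N by (simp add: V_def)
  also have "\<dots> = ln B + \<beta> * S + ln (card V) - p * N"
    using \<open>0 < card V\<close> B by (simp add: ln_mult)
  finally have "p * N - ln B \<le> ln (card V) + \<beta> * S" by simp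
  then have "(p * N - ln B) / N \<le> (ln (card V) + \<beta> * S) / N" by (rule divide_right_mono) simp
  moreover have "(p * N - ln B) / N = p - ln B / N" using \<open>R \<le> N\<close> R by (simp add: field_simps)
  moreover have "ln B / N \<le> ln B / R" using \<open>R \<le> N\<close> R B by (intro divide_left_mono) auto
  ultimately have "ereal (p - ln B / R) \<le> ereal ((ln (card V) + \<beta> * S) / N)" by simp
  also have "\<dots> \<le> pressure X A \<beta>"
    unfolding S_def R_def
  proof (rule pressure_words[OF _ _ \<open>V \<noteq> {}\<close> _ \<beta>])
    show "V \<subseteq> chain (r * k) 0" unfolding V_def R_def by blast
    show "length v = N" if "v \<in> V" for v using that unfolding V_def by blast
    show "1 \<le> N" using \<open>R \<le> N\<close> R by linarith
  qed
  finally show ?thesis by (simp add: B_def R_def)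
qed

lemma pressure_chain:
  assumes \<beta>: "\<beta> \<ge> 0" and ge: "1 \<le> (\<Prod>i<k. link_weight \<beta> p i)"
  shows "ereal p \<le> pressure X A \<beta>"
proof -
  define f where "f n = p - (ln (real n) / real n + ln (real (Lm + 1)) / real n)" for n
  have "f \<longlonglongrightarrow> p - (0 + 0)"
    unfolding f_def by (intro tendsto_intros lim_ln_over_n lim_const_over_n)
  then have "(\<lambda>r. f (r * k)) \<longlonglongrightarrow> p"
    using filterlim_compose[of f _ sequentially "\<lambda>r. r * k"] mult_nat_right_at_top[of k] k_pos by simp
  then have lim: "(\<lambda>r. ereal (f (r * k))) \<longlonglongrightarrow> ereal p" by simp
  have "ereal (f (r * k)) \<le> pressure X A \<beta>" if r: "r \<ge> 1" for r
  proof -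
    have R: "real (r * k) \<ge> 1" using r k_pos by (metis One_nat_def Suc_le_eq nat_0_less_mult_iff of_nat_1 of_nat_mono)
    have "ln (real (r * k * Lm + 1)) \<le> ln (real (r * k) * real (Lm + 1))"
      using R by (intro ln_mono) (auto simp: algebra_simps intro: add_pos_nonneg)
    also have "\<dots> = ln (real (r * k)) + ln (real (Lm + 1))" using R by (intro ln_mult_pos) auto
    finally have "ln (real (r * k * Lm + 1)) / real (r * k) \<le> ln (real (r * k)) / real (r * k) + ln (real (Lm + 1)) / real (r * k)"
      unfolding add_divide_distrib[symmetric] by (rule divide_right_mono) simp
    then have "ereal (f (r * k)) \<le> ereal (p - ln (real (r * k * Lm + 1)) / real (r * k))"
      by (simp only: f_def ereal_less_eq diff_left_mono)
    also have "\<dots> \<le> pressure X A \<beta>" by (rule pressure_chain_approx[OF \<beta> ge r])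
    finally show ?thesis .
  qed
  then show ?thesis by (intro LIMSEQ_le_const2[OF lim]) blast
qed

end

section \<open>Pressure of a cycle of components\<close>

definition block_words :: "nat \<Rightarrow> nat \<Rightarrow> (nat \<Rightarrow> nat) set \<Rightarrow> nat list \<Rightarrow> nat list \<Rightarrow> nat list set" where
  "block_words m B C \<alpha> b = {prefix n x | n x. n < B \<and> x \<in> C \<and> prefix m x = \<alpha> \<and> prefix m (suffix n x) = b}"

lemma block_words_subset: "block_words m B C \<alpha> b \<subseteq> (\<Union>n\<in>{..<B}. prefix n ` C)"
  unfolding block_words_def by blast

context sft_potential
begin

lemma finite_block_words:
  assumes "C \<subseteq> X"
  shows "finite (block_words m B C \<alpha> b)"
  by (rule finite_subset[OF block_words_subset]) (simp add: finite_prefix_X[OF assms])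

text \<open>Birkhoff sums vanish on the component, and exchanging the tail behind the overlap
  \<open>b\<close> changes them by the Lipschitz error only.\<close>

lemma block_words_link:
  assumes C: "C \<in> irreducible_components X A" and w: "w \<in> block_words (Suc m) B C \<alpha> b"
    and x': "x' \<in> X" "prefix (Suc m) x' = b"
  shows "w \<frown> x' \<in> X" "prefix (Suc m) (w \<frown> x') = \<alpha>"
    "- (L * (1/2) ^ Suc m) \<le> birkhoff_sum A (length w) (w \<frown> x')"
proof -
  obtain n x where x: "w = prefix n x" "x \<in> C" "prefix (Suc m) x = \<alpha>" "prefix (Suc m) (suffix n x) = b"
    using w unfolding block_words_def by blast
  have xX: "x \<in> X" using x(2) component_subset_X[OF C] by blast
  have *: "w \<frown> x' \<in> X" "prefix (n + Suc m) (w \<frown> x') = prefix (n + Suc m) x"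
    using conc_prefix[OF xX x'(1), of m n] unfolding x(1,4) x'(2) by blast+
  show "w \<frown> x' \<in> X" by (rule *(1))
  have "prefix (Suc m) (w \<frown> x') = prefix (Suc m) x" using *(2) by (rule prefix_eq_mono) simp
  then show "prefix (Suc m) (w \<frown> x') = \<alpha>" using x(3) by simp
  have "length w = n" by (simp add: x(1))
  then show "- (L * (1/2) ^ Suc m) \<le> birkhoff_sum A (length w) (w \<frown> x')"
    using birkhoff_lip[OF *(1) xX *(2)] component_birkhoff[OF C x(2), of n]
    unfolding \<open>length w = n\<close> by linarith
qed

text \<open>In the point of \<open>C\<close> that begins with \<open>w'\<close>, the letter
  \<open>c\<close> would be followed by \<open>w\<close> and \<open>b\<close>, hence by
  \<open>\<alpha>\<close>. If \<open>w\<close> is shorter than \<open>m\<close>, the remainder of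
  \<open>\<alpha>\<close> lies in \<open>b\<close>, which both points share. Invariance of
  \<open>C\<close> then puts \<open>c # \<alpha>\<close> among its words.\<close>

lemma block_words_decode:
  assumes C: "C \<in> irreducible_components X A"
    and w: "w \<in> block_words m B C \<alpha> b" "w' \<in> block_words m B C \<alpha> b"
    and c: "c # \<alpha> \<notin> prefix (Suc m) ` C"
  shows "w' \<noteq> v @ c # w"
proof
  assume eq: "w' = v @ c # w"
  obtain n x where x: "w = prefix n x" "x \<in> C" "prefix m x = \<alpha>" "prefix m (suffix n x) = b"
    using w(1) unfolding block_words_def by blast
  obtain n' x' where x': "w' = prefix n' x'" "x' \<in> C" "prefix m x' = \<alpha>" "prefix m (suffix n' x') = b"
    using w(2) unfolding block_words_def by blast
  define y where "y = suffix (length v) x'"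
  have "length w' = n'" "length w = n" by (simp_all add: x x')
  then have n': "n' = length v + Suc n" using eq by simp
  have y: "y \<in> C" unfolding y_def by (rule component_suffix[OF C x'(2)])
  have w'_nth: "w' ! (length v + j) = y j" if "j < Suc n" for j
    using that by (simp add: x'(1) y_def n' del: subseq_to_Suc)
  have "y 0 = c" using w'_nth[of 0] by (simp add: eq)
  moreover have "y (Suc j) = x j" if j: "j < m" for j
  proof (cases "j < n")
    case True
    then have "y (Suc j) = w ! j" using w'_nth[of "Suc j"] by (simp add: eq nth_append)
    then show ?thesis using True by (simp add: x(1))
  next
    case False
    have "prefix m (suffix n' x') = prefix m (suffix n x)" using x(4) x'(4) by simp
    then have "x' (n' + (j - n)) = x (n + (j - n))" unfolding prefix_eq_iff suffix_nth using j by auto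
    then show ?thesis using False by (simp add: y_def n')
  qed
  ultimately have "prefix (Suc m) y = c # prefix m x"
    by (auto simp: list_eq_iff_nth_eq nth_Cons simp del: subseq_to_Suc split: nat.split)
  with y c x(3) show False by force
qed

text \<open>Each of the at least \<open>1 / \<delta>\<close> lengths contributes at least
  \<open>exp (-2)\<close>, as the number of words makes up for the factor
  \<open>exp (- h * n)\<close>. The pigeonhole principle over the pairs of overlaps divides the
  total by the number of pairs.\<close>

lemma popular_block_words:
  assumes C: "C \<in> irreducible_components X A" and h: "topological_entropy C = ereal h"
    and \<delta>: "0 < \<delta>" "\<delta> \<le> 1"
  shows "\<exists>\<alpha>\<in>prefix m ` C. \<exists>b\<in>prefix m ` C. exp (-2) / (\<delta> * real (word_count m C) ^ 2) \<le>
    (\<Sum>w\<in>block_words m (nat \<lceil>1 / \<delta>\<rceil>) C \<alpha> b. exp (- ((h + \<delta>) * real (length w))))"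
proof -
  define B where "B = nat \<lceil>1 / \<delta>\<rceil>"
  define g where "g w = exp (- ((h + \<delta>) * real (length w)))" for w :: "nat list"
  define W where "W = (\<Union>n\<in>{..<B}. prefix n ` C)"
  have CX: "C \<subseteq> X" by (rule component_subset_X[OF C])
  have fin: "\<And>n. finite (prefix n ` C)" by (rule finite_prefix_X[OF CX])
  have B: "1 / \<delta> \<le> real B" "real B < 1 / \<delta> + 1"
    using \<delta> unfolding B_def by (simp_all add: of_nat_nat ceiling_less_iff) linarith+
  have "\<delta> * real B < \<delta> * (1 / \<delta> + 1)" using B(2) \<delta>(1) by (rule mult_strict_left_mono)
  also have "\<dots> = 1 + \<delta>" using \<delta>(1) by (simp add: distrib_left)
  \<comment> \<open>This is the origin of \<open>exp (-2)\<close>: the damping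
    \<open>exp (- \<delta> * n)\<close> stays above it for all lengths below
    \<open>B\<close>.\<close>
  finally have \<delta>B: "\<delta> * real B \<le> 2" using \<delta>(2) by simp
  have sumW: "exp (-2) / \<delta> \<le> (\<Sum>w\<in>W. g w)"
  proof -
    have disj: "prefix i ` C \<inter> prefix j ` C = {}" if "i \<noteq> j" for i j
      using that by (auto dest!: arg_cong[where f = length])
    have "(\<Sum>w\<in>W. g w) = (\<Sum>n<B. \<Sum>w\<in>prefix n ` C. g w)"
      unfolding W_def by (rule sum.UNION_disjoint) (use fin disj in simp_all)
    also have "\<dots> = (\<Sum>n<B. real (word_count n C) * exp (- ((h + \<delta>) * n)))"
    proof (rule sum.cong[OF refl])
      fix n
      have "(\<Sum>w\<in>prefix n ` C. g w) = (\<Sum>w\<in>prefix n ` C. exp (- ((h + \<delta>) * n)))"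
        by (rule sum.cong) (auto simp: g_def)
      then show "(\<Sum>w\<in>prefix n ` C. g w) = real (word_count n C) * exp (- ((h + \<delta>) * n))"
        by (simp add: word_count_def)
    qed
    finally have eq: "(\<Sum>w\<in>W. g w) = (\<Sum>n<B. real (word_count n C) * exp (- ((h + \<delta>) * n)))" .
    have summand: "exp (-2) \<le> real (word_count n C) * exp (- ((h + \<delta>) * n))" if n: "n < B" for n
    proof -
      obtain h' where h': "topological_entropy C = ereal h'" "exp (h' * real n) \<le> word_count n C"
        using topological_entropy_word_count[OF fin component_suffix[OF C] component_nonempty[OF C]] by metis
      have "\<delta> * n \<le> \<delta> * B" using n \<delta> by (intro mult_left_mono) auto
      then have "exp (-2) \<le> exp (- (\<delta> * n))" using \<delta>B by simp
      also have "\<dots> = exp (h * n) * exp (- ((h + \<delta>) * n))"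
        by (simp add: algebra_simps flip: exp_add)
      also have "\<dots> \<le> real (word_count n C) * exp (- ((h + \<delta>) * n))"
        using h' h by (intro mult_right_mono) auto
      finally show ?thesis .
    qed
    have "exp (-2) / \<delta> = (1 / \<delta>) * exp (-2)" by simp
    also have "\<dots> \<le> B * exp (-2)" using B(1) by (rule mult_right_mono) simp
    also have "\<dots> = (\<Sum>n<B. exp (-2))" by simp
    also have "\<dots> \<le> (\<Sum>n<B. real (word_count n C) * exp (- ((h + \<delta>) * n)))"
      using summand by (intro sum_mono) auto
    finally show ?thesis unfolding eq .
  qed
  \<comment> \<open>A word does not determine its continuation, so one point of \<open>C\<close> is
    picked for each word, and its overlaps classify the word.\<close>
  have "\<forall>w\<in>W. \<exists>x\<in>C. w = prefix (length w) x" by (auto simp: W_def)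
  then obtain rep where rep: "\<And>w. w \<in> W \<Longrightarrow> rep w \<in> C" "\<And>w. w \<in> W \<Longrightarrow> w = prefix (length w) (rep w)"
    by metis
  define \<pi> where "\<pi> w = (prefix m (rep w), prefix m (suffix (length w) (rep w)))" for w
  define P where "P = prefix m ` C \<times> prefix m ` C"
  define q where "q = exp (-2) / (\<delta> * real (word_count m C) ^ 2)"
  have finP: "finite P" unfolding P_def using fin by blast
  have finW: "finite W" unfolding W_def using fin by blast
  have cardP: "real (card P) = real (word_count m C) ^ 2"
    by (simp add: P_def card_cartesian_product word_count_def power2_eq_square)
  have wc: "real (word_count m C) \<ge> 1"
    using word_count_ge_1[OF component_nonempty[OF C] fin, of m] by simp
  have \<pi>P: "\<pi> ` W \<subseteq> P"
    unfolding P_def \<pi>_def using rep(1) component_suffix[OF C] by blast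
  have fibre: "{w \<in> W. \<pi> w = (\<alpha>, b)} \<subseteq> block_words m B C \<alpha> b" for \<alpha> b
  proof
    fix w assume w: "w \<in> {w \<in> W. \<pi> w = (\<alpha>, b)}"
    have "length w < B" using w by (auto simp: W_def)
    moreover have "rep w \<in> C" "w = prefix (length w) (rep w)" using rep w by auto
    moreover have "prefix m (rep w) = \<alpha>" "prefix m (suffix (length w) (rep w)) = b"
      using w unfolding \<pi>_def by blast+
    ultimately show "w \<in> block_words m B C \<alpha> b" unfolding block_words_def by blast
  qed
  have "\<exists>(\<alpha>, b)\<in>P. q \<le> (\<Sum>w\<in>block_words m B C \<alpha> b. g w)"
  proof (rule ccontr)
    assume "\<not> ?thesis"
    then have less: "(\<Sum>w\<in>block_words m B C \<alpha> b. g w) < q" if "(\<alpha>, b) \<in> P" for \<alpha> b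
      using that by fastforce
    have "(\<Sum>w\<in>W. g w) = (\<Sum>pr\<in>P. \<Sum>w\<in>{w \<in> W. \<pi> w = pr}. g w)"
      by (rule sum.group[symmetric, OF finW finP \<pi>P])
    also have "\<dots> < (\<Sum>pr\<in>P. q)"
    proof (rule sum_strict_mono[OF finP])
      show "P \<noteq> {}" using component_nonempty[OF C] by (auto simp: P_def)
      fix pr assume pr: "pr \<in> P"
      obtain \<alpha> b where ab: "pr = (\<alpha>, b)" by fastforce
      have "(\<Sum>w\<in>{w \<in> W. \<pi> w = pr}. g w) \<le> (\<Sum>w\<in>block_words m B C \<alpha> b. g w)"
        unfolding ab by (rule sum_mono2[OF finite_block_words[OF CX] fibre]) (simp add: g_def)
      also have "\<dots> < q" using less pr ab by blast
      finally show "(\<Sum>w\<in>{w \<in> W. \<pi> w = pr}. g w) < q" .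
    qed
    also have "\<dots> = exp (-2) / \<delta>" using wc \<delta> by (simp add: q_def cardP)
    finally show False using sumW by simp
  qed
  then show ?thesis unfolding P_def q_def B_def g_def by blast
qed

text \<open>The constant \<open>c\<close> must not depend on \<open>\<beta>\<close>, although the start and end words of the visits, chosen
  to be the most popular ones, do.\<close>

lemma pressure_cycle:
  fixes C :: "nat \<Rightarrow> (nat \<Rightarrow> nat) set" and s :: "nat \<Rightarrow> real"
  assumes k: "k \<ge> 1" and C: "\<And>t. C t \<in> irreducible_components X A"
    and h: "\<And>t. topological_entropy (C t) = ereal h"
    and per: "\<And>t. C (t + k) = C t" "\<And>t. s (t + k) = s t"
    and s: "\<And>t. ereal (s t) < S_ext X A (C (Suc t)) (C t)"
  obtains c where "0 < c" "c \<le> 1"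
    "\<And>\<beta> \<delta>. 0 \<le> \<beta> \<Longrightarrow> 0 < \<delta> \<Longrightarrow> \<delta> \<le> 1 \<Longrightarrow> 1 \<le> (c / \<delta>) ^ k * exp (\<beta> * (\<Sum>i<k. s i)) \<Longrightarrow>
      ereal (h + \<delta>) \<le> pressure X A \<beta>"
proof -
  have CX: "C t \<subseteq> X" for t by (rule component_subset_X[OF C])
  have fin: "finite (prefix n ` C t)" for n t by (rule finite_prefix_X[OF CX])
  have C_mod: "C (t mod k) = C t" and s_mod: "s (t mod k) = s t" for t
  proof -
    have *: "C (t + k * j) = C t \<and> s (t + k * j) = s t" for t j
    proof (induction j)
      case (Suc j)
      then show ?case using per[of "t + k * j"] by (simp add: ac_simps)
    qed simp
    show "C (t mod k) = C t" "s (t mod k) = s t"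
      using *[of "t mod k" "t div k"] by simp_all
  qed
  \<comment> \<open>The surplus \<open>L * (1/2) ^ m\<close> pays for the component word that is put
    in front of \<open>u\<close>.\<close>
  define good where "good m t \<alpha> b u \<longleftrightarrow> u \<noteq> [] \<and> last u # \<alpha> \<notin> prefix (Suc m) ` C t \<and>
      (\<forall>x'\<in>X. prefix m x' = \<alpha> \<longrightarrow> u \<frown> x' \<in> X \<and> prefix m (u \<frown> x') = b \<and>
        s t + L * (1/2) ^ m \<le> birkhoff_sum A (length u) (u \<frown> x'))" for m t \<alpha> b and u :: "nat list"
  have "\<exists>m0. \<forall>m\<ge>m0. \<forall>\<alpha>\<in>prefix m ` C t. \<forall>b\<in>prefix m ` C (Suc t). \<exists>u. good m t \<alpha> b u" for t
  proof -
    obtain s' where s': "s t < s'" "ereal s' < S_ext X A (C (Suc t)) (C t)"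
      using ereal_dense2[OF s[of t]] by auto
    obtain m1 where m1: "\<And>m x y. m \<ge> m1 \<Longrightarrow> x \<in> C t \<Longrightarrow> y \<in> C (Suc t) \<Longrightarrow>
      \<exists>u. u \<noteq> [] \<and> last u # prefix m x \<notin> prefix (Suc m) ` C t \<and>
        (\<forall>x'\<in>X. prefix m x' = prefix m x \<longrightarrow> u \<frown> x' \<in> X \<and> prefix m (u \<frown> x') = prefix m y \<and>
          s' \<le> birkhoff_sum A (length u) (u \<frown> x'))"
      using transition_word[OF C C s'(2)] by blast
    obtain m2 where m2: "\<And>m. m \<ge> m2 \<Longrightarrow> L * (1/2) ^ m < s' - s t"
      using exists_small[of "s' - s t"] s'(1) by auto
    show ?thesis
    proof (intro exI[of _ "m1 + m2"] allI impI ballI)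
      fix m \<alpha> b assume m: "m1 + m2 \<le> m" and ab: "\<alpha> \<in> prefix m ` C t" "b \<in> prefix m ` C (Suc t)"
      then obtain x y where xy: "x \<in> C t" "\<alpha> = prefix m x" "y \<in> C (Suc t)" "b = prefix m y" by blast
      obtain u where u: "u \<noteq> []" "last u # prefix m x \<notin> prefix (Suc m) ` C t"
        "\<And>x'. x' \<in> X \<Longrightarrow> prefix m x' = prefix m x \<Longrightarrow> u \<frown> x' \<in> X \<and> prefix m (u \<frown> x') = prefix m y \<and>
          s' \<le> birkhoff_sum A (length u) (u \<frown> x')" using m1[of m x y] m xy by auto
      have "L * (1/2) ^ m < s' - s t" using m2 m by simp
      then have "good m t \<alpha> b u" unfolding good_def xy using u by fastforce
      then show "\<exists>u. good m t \<alpha> b u" by blast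
    qed
  qed
  then obtain m0 where m0: "\<And>t m \<alpha> b. m \<ge> m0 t \<Longrightarrow> \<alpha> \<in> prefix m ` C t \<Longrightarrow> b \<in> prefix m ` C (Suc t) \<Longrightarrow>
    \<exists>u. good m t \<alpha> b u" by metis
  define m' where "m' = (\<Sum>t<k. m0 t)"
  define m where "m = Suc m'"
  have "\<exists>u. good m t \<alpha> b u" if "t < k" "\<alpha> \<in> prefix m ` C t" "b \<in> prefix m ` C (Suc t)" for t \<alpha> b
  proof (rule m0[OF _ that(2,3)])
    have "m0 t \<le> m'" unfolding m'_def using that(1) by (intro member_le_sum) auto
    then show "m0 t \<le> m" by (simp add: m_def)
  qed
  then obtain U where U: "\<And>t \<alpha> b. t < k \<Longrightarrow> \<alpha> \<in> prefix m ` C t \<Longrightarrow> b \<in> prefix m ` C (Suc t) \<Longrightarrow>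
    good m t \<alpha> b (U t \<alpha> b)" by metis
  define I where "I = (SIGMA t:{..<k}. prefix m ` C t \<times> prefix m ` C (Suc t))"
  have finI: "finite I" unfolding I_def using fin by blast
  \<comment> \<open>The maximum is bounded over all overlaps at once, before the popular ones, which
    vary with \<open>\<delta>\<close>, are known.\<close>
  define T where "T = (\<Sum>(t, \<alpha>, b)\<in>I. length (U t \<alpha> b))"
  have T: "length (U t \<alpha> b) \<le> T" if "t < k" "\<alpha> \<in> prefix m ` C t" "b \<in> prefix m ` C (Suc t)" for t \<alpha> b
    using member_le_sum[of "(t, \<alpha>, b)" I "\<lambda>(t, \<alpha>, b). length (U t \<alpha> b)"] finI that
    by (simp add: T_def I_def)
  define K where "K = (\<Sum>t<k. real (word_count m (C t)) ^ 2)"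
  have wc: "1 \<le> real (word_count m (C t))" for t
    using word_count_ge_1[OF component_nonempty[OF C] fin, of m t] by simp
  have K: "real (word_count m (C t)) ^ 2 \<le> K" if "t < k" for t
    unfolding K_def using that by (intro member_le_sum) auto
  have "1 \<le> real (word_count m (C 0)) ^ 2" using wc by (rule one_le_power)
  then have K1: "1 \<le> K" using K[of 0] k by simp
  have h0: "0 \<le> h"
    using topological_entropy_word_count[OF fin component_suffix[OF C] component_nonempty[OF C]] h
    by (metis ereal.inject)
  \<comment> \<open>\<open>exp (-2)\<close> comes from the cut-off of the visits and
    \<open>K\<close> from the number of pairs of overlaps. The middle factor is the weight of the
    longest transition word, with \<open>h + \<delta>\<close> replaced by
    \<open>h + 1\<close>.\<close>
  define c where "c = exp (-2) * exp (- ((h + 1) * T)) / K"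
  have c_pos: "0 < c" using K1 by (simp add: c_def)
  have "exp (-2) * exp (- ((h + 1) * T)) \<le> 1 * (1 :: real)"
    using h0 by (intro mult_mono) auto
  then have c_le: "c \<le> 1" using K1 by (simp add: c_def divide_le_eq)
  show thesis
  proof (rule that[OF c_pos c_le])
    fix \<beta> \<delta> :: real
    assume \<beta>: "0 \<le> \<beta>" and \<delta>: "0 < \<delta>" "\<delta> \<le> 1" and ge: "1 \<le> (c / \<delta>) ^ k * exp (\<beta> * (\<Sum>i<k. s i))"
    define B where "B = nat \<lceil>1 / \<delta>\<rceil>"
    define p where "p = h + \<delta>"
    have "\<exists>\<alpha> b. \<alpha> \<in> prefix m ` C t \<and> b \<in> prefix m ` C t \<and>
        exp (-2) / (\<delta> * real (word_count m (C t)) ^ 2) \<le>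
        (\<Sum>w\<in>block_words m B (C t) \<alpha> b. exp (- (p * real (length w))))" for t
      using popular_block_words[OF C h \<delta>, of m t] unfolding B_def p_def by blast
    then obtain al be where ab: "\<And>t. al t \<in> prefix m ` C t" "\<And>t. be t \<in> prefix m ` C t"
      "\<And>t. exp (-2) / (\<delta> * real (word_count m (C t)) ^ 2) \<le>
        (\<Sum>w\<in>block_words m B (C t) (al t) (be t). exp (- (p * real (length w))))" by metis
    \<comment> \<open>The overlaps were chosen separately for every \<open>t\<close>, so periodicity
      has to be imposed.\<close>
    define a where "a t = al (t mod k)" for t
    define b where "b t = be (t mod k)" for t
    define u where "u t = U (t mod k) (a t) (b (Suc t))" for t
    define W where "W t = block_words m B (C t) (a t) (b t)" for t
    have mod_less: "t mod k < k" for t using k by simp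
    have C_Suc: "C (Suc (t mod k)) = C (Suc t)" for t
      using C_mod[of "Suc (t mod k)"] C_mod[of "Suc t"] by (simp add: mod_Suc_eq)
    have a_in: "a t \<in> prefix m ` C t" and b_in: "b t \<in> prefix m ` C t" for t
      using ab(1,2)[of "t mod k"] by (simp_all add: a_def b_def C_mod)
    have u_good: "good m (t mod k) (a t) (b (Suc t)) (u t)" for t
      unfolding u_def by (rule U[OF mod_less]) (simp_all only: C_mod C_Suc a_in b_in)
    have u_len: "length (u t) \<le> T" for t
      unfolding u_def by (rule T[OF mod_less]) (simp_all only: C_mod C_Suc a_in b_in)
    have u_ne: "u t \<noteq> []" and u_exit: "last (u t) # a t \<notin> prefix (Suc m) ` C t"
      and u_link: "\<And>x'. x' \<in> X \<Longrightarrow> prefix m x' = a t \<Longrightarrow> u t \<frown> x' \<in> X \<and> prefix m (u t \<frown> x') = b (Suc t) \<and>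
        s t + L * (1/2) ^ m \<le> birkhoff_sum A (length (u t)) (u t \<frown> x')" for t
      using u_good[of t] unfolding good_def C_mod s_mod by blast+
    interpret word_chain D M A X L m k "B + T" a u W s
    proof
      show "u t \<noteq> []" for t by (rule u_ne)
      show "finite (W t)" for t unfolding W_def by (rule finite_block_words[OF CX])
      show "w' \<noteq> v @ last (u (Suc t)) # w" if "w \<in> W (Suc t)" "w' \<in> W (Suc t)" for w w' v t
        by (rule block_words_decode[OF C that[unfolded W_def] u_exit])
      show "length (w @ u t) \<le> B + T" if "w \<in> W (Suc t)" for w t
      proof -
        have "w \<in> (\<Union>n\<in>{..<B}. prefix n ` C (Suc t))"
          using that block_words_subset unfolding W_def by blast
        then have "length w \<le> B" by auto
        then show ?thesis using u_len[of t] by simp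
      qed
      show "a (t + k) = a t" "u (t + k) = u t" "W (t + k) = W t" "s (t + k) = s t" for t
      proof -
        have "Suc (t + k) mod k = Suc t mod k" by (metis add_Suc mod_add_self2)
        then show "a (t + k) = a t" "u (t + k) = u t" "W (t + k) = W t" "s (t + k) = s t"
          by (simp_all add: a_def b_def u_def W_def per)
      qed
      show "\<exists>\<xi>\<in>X. prefix m \<xi> = a 0" using a_in[of 0] CX[of 0] by auto
      show "(w @ u t) \<frown> \<xi> \<in> X \<and> prefix m ((w @ u t) \<frown> \<xi>) = a (Suc t) \<and>
          s t \<le> birkhoff_sum A (length (w @ u t)) ((w @ u t) \<frown> \<xi>)"
        if \<xi>: "\<xi> \<in> X" "prefix m \<xi> = a t" and w: "w \<in> W (Suc t)" for \<xi> t w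
      proof -
        have 1: "u t \<frown> \<xi> \<in> X" "prefix m (u t \<frown> \<xi>) = b (Suc t)"
          "s t + L * (1/2) ^ m \<le> birkhoff_sum A (length (u t)) (u t \<frown> \<xi>)"
          using u_link[OF \<xi>] by blast+
        have 2: "w \<frown> u t \<frown> \<xi> \<in> X" "prefix m (w \<frown> u t \<frown> \<xi>) = a (Suc t)"
          "- (L * (1/2) ^ m) \<le> birkhoff_sum A (length w) (w \<frown> u t \<frown> \<xi>)"
          using block_words_link[OF C w[unfolded W_def m_def] 1(1)] 1(2) unfolding m_def by blast+
        have "birkhoff_sum A (length (w @ u t)) (w \<frown> u t \<frown> \<xi>) =
            birkhoff_sum A (length w) (w \<frown> u t \<frown> \<xi>) + birkhoff_sum A (length (u t)) (u t \<frown> \<xi>)"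
          using birkhoff_sum_add[of A "length w" "length (u t)" "w \<frown> u t \<frown> \<xi>"]
          unfolding suffix_conc_length length_append .
        then have "s t \<le> birkhoff_sum A (length (w @ u t)) (w \<frown> u t \<frown> \<xi>)"
          using 1(3) 2(3) by linarith
        then show ?thesis using 2(1,2) unfolding conc_conc by blast
      qed
    qed (rule k)
    have weight: "c / \<delta> * exp (\<beta> * s t) \<le> link_weight \<beta> p t" for t
    proof -
      have "W (Suc t) = block_words m B (C (Suc t mod k)) (al (Suc t mod k)) (be (Suc t mod k))"
        unfolding W_def a_def b_def C_mod ..
      then have 1: "exp (-2) / (\<delta> * real (word_count m (C (Suc t mod k))) ^ 2) \<le>
          (\<Sum>w\<in>W (Suc t). exp (- (p * real (length w))))" using ab(3)[of "Suc t mod k"] by simp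
      have "\<delta> * real (word_count m (C (Suc t mod k))) ^ 2 \<le> \<delta> * K"
        using K[OF mod_less] \<delta> by (intro mult_left_mono) auto
      moreover have "0 < \<delta> * real (word_count m (C (Suc t mod k))) ^ 2"
        using wc[of "Suc t mod k"] \<delta> by simp
      ultimately have "exp (-2) / (\<delta> * K) \<le> exp (-2) / (\<delta> * real (word_count m (C (Suc t mod k))) ^ 2)"
        by (intro divide_left_mono) (auto intro: mult_pos_pos)
      with 1 have 2: "exp (-2) / (\<delta> * K) \<le> (\<Sum>w\<in>W (Suc t). exp (- (p * real (length w))))" by linarith
      have "p * length (u t) \<le> (h + 1) * T"
        using u_len[of t] h0 \<delta> unfolding p_def by (intro mult_mono) auto
      then have 3: "exp (- ((h + 1) * T)) \<le> exp (- (p * real (length (u t))))" by simp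
      have "c / \<delta> = exp (-2) / (\<delta> * K) * exp (- ((h + 1) * T))" by (simp add: c_def)
      also have "\<dots> \<le> (\<Sum>w\<in>W (Suc t). exp (- (p * real (length w)))) * exp (- (p * real (length (u t))))"
        using 2 3 by (rule mult_mono) (auto intro: sum_nonneg)
      finally have "exp (\<beta> * s t) * (c / \<delta>) \<le> link_weight \<beta> p t"
        unfolding link_weight_def by (rule mult_left_mono) simp
      then show ?thesis by (simp add: mult.commute)
    qed
    have "(c / \<delta>) ^ k * exp (\<beta> * (\<Sum>i<k. s i)) = (\<Prod>i<k. c / \<delta> * exp (\<beta> * s i))"
      by (simp add: prod.distrib sum_distrib_left exp_sum power_divide prod_dividef)
    also have "\<dots> \<le> (\<Prod>i<k. link_weight \<beta> p i)"
      using weight c_pos \<delta> by (intro prod_mono) auto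
    finally have "1 \<le> (\<Prod>i<k. link_weight \<beta> p i)" using ge by linarith
    from pressure_chain[OF \<beta> this] show "ereal (h + \<delta>) \<le> pressure X A \<beta>" by (simp add: p_def)
  qed
qed

end

section \<open>The lower bound for the pressure\<close>

lemma ereal_ln_mono:
  assumes "ereal x \<le> y" "0 < x"
  shows "ereal (ln x) \<le> ereal_ln y"
  using assms by (cases y) (auto simp: ereal_ln_def)

context sft_potential
begin

text \<open>This leaves \<open>-\<infinity>\<close> as the only possible non-finite entry, and makes
  cycle means non-positive, so that \<open>c * exp (\<beta> * avg)\<close> is an admissible
  \<open>\<delta>\<close>.\<close>

lemma S_ext_nonpos:
  assumes "C \<in> irreducible_components X A"
  shows "S_ext X A C' C \<le> 0"
proof -
  obtain x where x: "x \<in> C" using component_nonempty[OF assms] by blast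
  have "Sup {mane_potential X A y z + ereal (A z) | y z. z \<in> X \<and> shift z = x \<and> z \<notin> C \<and> y \<in> C'} \<le> 0"
  proof (rule Sup_least)
    fix v assume "v \<in> {mane_potential X A y z + ereal (A z) | y z. z \<in> X \<and> shift z = x \<and> z \<notin> C \<and> y \<in> C'}"
    then obtain y z where v: "v = mane_potential X A y z + ereal (A z)" "z \<in> X" by blast
    have "mane_potential X A y z + ereal (A z) \<le> 0 + 0"
      using A_nonpos[OF v(2)] by (intro add_mono mane_nonpos) simp
    then show "v \<le> 0" using v(1) by simp
  qed
  then show ?thesis unfolding S_ext_def by (rule INF_lower2[OF x])
qed

lemma liminf_cycle:
  fixes C :: "nat \<Rightarrow> (nat \<Rightarrow> nat) set" and s :: "nat \<Rightarrow> real"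
  assumes k: "k \<ge> 1" and C: "\<And>t. C t \<in> irreducible_components X A"
    and h: "\<And>t. topological_entropy (C t) = ereal h"
    and per: "\<And>t. C (t + k) = C t" "\<And>t. s (t + k) = s t"
    and s: "\<And>t. ereal (s t) < S_ext X A (C (Suc t)) (C t)"
  shows "ereal ((\<Sum>i<k. s i) / k) \<le> Liminf at_top (\<lambda>\<beta>. ereal (1 / \<beta>) * ereal_ln (pressure X A \<beta> - ereal h))"
proof -
  obtain c where c: "0 < c" "c \<le> 1"
    "\<And>\<beta> \<delta>. 0 \<le> \<beta> \<Longrightarrow> 0 < \<delta> \<Longrightarrow> \<delta> \<le> 1 \<Longrightarrow> 1 \<le> (c / \<delta>) ^ k * exp (\<beta> * (\<Sum>i<k. s i)) \<Longrightarrow>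
      ereal (h + \<delta>) \<le> pressure X A \<beta>"
    by (rule pressure_cycle[OF k C h per s]) blast
  define avg where "avg = (\<Sum>i<k. s i) / k"
  have "s t \<le> 0" for t
    using less_le_trans[OF s[of t] S_ext_nonpos[OF C]] by simp
  then have "avg \<le> 0" unfolding avg_def by (intro divide_nonpos_nonneg sum_nonpos) auto
  have sum_s: "(\<Sum>i<k. s i) = k * avg" using k by (simp add: avg_def)
  have bound: "ereal (ln c / \<beta> + avg) \<le> ereal (1 / \<beta>) * ereal_ln (pressure X A \<beta> - ereal h)"
    if \<beta>: "\<beta> > 0" for \<beta>
  proof -
    \<comment> \<open>The largest value for which the condition on a full turn holds; it holds with
      equality. Its logarithm divided by \<open>\<beta>\<close> is
      \<open>ln c / \<beta> + avg\<close>.\<close>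
    define \<delta> where "\<delta> = c * exp (\<beta> * avg)"
    have \<delta>: "0 < \<delta>" using c(1) by (simp add: \<delta>_def)
    have "c * exp (\<beta> * avg) \<le> 1 * 1"
      using c \<beta> \<open>avg \<le> 0\<close> by (intro mult_mono) (auto simp: mult_nonneg_nonpos)
    then have \<delta>1: "\<delta> \<le> 1" by (simp add: \<delta>_def)
    have "(c / \<delta>) ^ k = exp (- (\<beta> * avg)) ^ k" using c(1) by (simp add: \<delta>_def exp_minus field_simps)
    also have "\<dots> = exp (- (\<beta> * (\<Sum>i<k. s i)))"
      by (simp add: sum_s algebra_simps flip: exp_of_nat_mult)
    finally have "(c / \<delta>) ^ k * exp (\<beta> * (\<Sum>i<k. s i)) = 1" by (simp add: exp_minus)
    then have "ereal (h + \<delta>) \<le> pressure X A \<beta>" using \<beta> \<delta> \<delta>1 by (intro c(3)) auto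
    then have "ereal \<delta> \<le> pressure X A \<beta> - ereal h" by (cases "pressure X A \<beta>") auto
    then have "ereal (ln \<delta>) \<le> ereal_ln (pressure X A \<beta> - ereal h)" using \<delta> by (rule ereal_ln_mono)
    then have "ereal (1 / \<beta>) * ereal (ln \<delta>) \<le> ereal (1 / \<beta>) * ereal_ln (pressure X A \<beta> - ereal h)"
      using \<beta> by (intro ereal_mult_left_mono) auto
    moreover have "ln \<delta> = ln c + \<beta> * avg" using c(1) by (simp add: \<delta>_def ln_mult)
    ultimately show ?thesis using \<beta> by (simp add: field_simps)
  qed
  have "((\<lambda>\<beta>. ln c / \<beta> + avg) \<longlongrightarrow> 0 + avg) at_top"
    by (intro tendsto_intros tendsto_divide_0[OF tendsto_const] filterlim_at_top_imp_at_infinity filterlim_ident)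
  then have "((\<lambda>\<beta>. ereal (ln c / \<beta> + avg)) \<longlongrightarrow> ereal avg) at_top" by simp
  then have "ereal avg = Liminf at_top (\<lambda>\<beta>. ereal (ln c / \<beta> + avg))"
    by (intro lim_imp_Liminf[symmetric]) auto
  also have "\<dots> \<le> Liminf at_top (\<lambda>\<beta>. ereal (1 / \<beta>) * ereal_ln (pressure X A \<beta> - ereal h))"
    by (rule Liminf_mono) (rule eventually_mono[OF eventually_gt_at_top[of 0] bound])
  finally show ?thesis by (simp add: avg_def)
qed

lemma liminf_cycle_mean:
  fixes C :: "nat \<Rightarrow> (nat \<Rightarrow> nat) set"
  assumes k: "k \<ge> 1" and C: "\<And>t. C t \<in> irreducible_components X A"
    and h: "\<And>t. topological_entropy (C t) = ereal h"
    and per: "\<And>t. C (t + k) = C t"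
  shows "(\<Sum>t<k. S_ext X A (C (Suc t)) (C t)) / ereal k \<le>
    Liminf at_top (\<lambda>\<beta>. ereal (1 / \<beta>) * ereal_ln (pressure X A \<beta> - ereal h))" (is "_ \<le> ?R")
proof (cases "\<exists>t<k. S_ext X A (C (Suc t)) (C t) = -\<infinity>")
  \<comment> \<open>The remaining entries cannot be \<open>\<infinity>\<close>, so the mean is
    \<open>-\<infinity>\<close> and the bound is trivial.\<close>
  case True
  then obtain t where t: "t < k" "S_ext X A (C (Suc t)) (C t) = -\<infinity>" by blast
  have "(\<Sum>i\<in>{..<k} - {t}. S_ext X A (C (Suc i)) (C i)) \<le> 0"
    using S_ext_nonpos[OF C] by (intro sum_nonpos)
  then have "(\<Sum>i<k. S_ext X A (C (Suc i)) (C i)) = -\<infinity>"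
    using t by (subst sum.remove[of _ t]) auto
  then show ?thesis using k by simp
next
  case False
  define \<sigma> where "\<sigma> t = real_of_ereal (S_ext X A (C (Suc t)) (C t))" for t
  have per_Suc: "C (Suc (t + k)) = C (Suc t)" for t using per[of "Suc t"] by simp
  have S_per: "S_ext X A (C (Suc (t mod k))) (C (t mod k)) = S_ext X A (C (Suc t)) (C t)" for t
  proof -
    have "C (j + k * i) = C j" for i j
    proof (induction i)
      case (Suc i)
      then show ?case using per[of "j + k * i"] by (simp add: ac_simps)
    qed simp
    from this[of "t mod k" "t div k"] this[of "Suc (t mod k)" "t div k"] show ?thesis by simp
  qed
  have S: "S_ext X A (C (Suc t)) (C t) = ereal (\<sigma> t)" for t
  proof -
    have "S_ext X A (C (Suc t)) (C t) \<noteq> -\<infinity>"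
      using False S_per[of t] k by (metis mod_less_divisor less_le_trans zero_less_one)
    then show ?thesis using S_ext_nonpos[OF C, of "C (Suc t)" t]
      unfolding \<sigma>_def by (cases "S_ext X A (C (Suc t)) (C t)") auto
  qed
  have mean: "(\<Sum>t<k. S_ext X A (C (Suc t)) (C t)) / ereal k = ereal ((\<Sum>t<k. \<sigma> t) / k)"
    using k by (simp add: S)
  show ?thesis unfolding mean
  \<comment> \<open>\<open>liminf_cycle\<close> wants reals strictly below the entries; lowering
    each entry by \<open>e\<close> lowers the mean by \<open>e\<close>.\<close>
  proof (rule ereal_le_epsilon2)
    fix e :: real assume e: "0 < e"
    have "ereal ((\<Sum>i<k. \<sigma> i - e) / k) \<le> ?R"
    proof (rule liminf_cycle[of k C h "\<lambda>t. \<sigma> t - e", OF k C h per])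
      show "\<sigma> (t + k) - e = \<sigma> t - e" for t by (simp add: \<sigma>_def per per_Suc)
      show "ereal (\<sigma> t - e) < S_ext X A (C (Suc t)) (C t)" for t using e by (simp add: S)
    qed
    moreover have "(\<Sum>i<k. \<sigma> i - e) / k = (\<Sum>t<k. \<sigma> t) / k - e"
      using k by (simp add: sum_subtractf diff_divide_distrib)
    ultimately have "ereal ((\<Sum>t<k. \<sigma> t) / k - e) + ereal e \<le> ?R + ereal e" by (intro add_right_mono) simp
    then show "ereal ((\<Sum>t<k. \<sigma> t) / k) \<le> ?R + ereal e" by simp
  qed
qed

end

theorem theorem1:
  fixes D :: nat and M :: "nat \<Rightarrow> nat \<Rightarrow> nat"
    and X :: "(nat \<Rightarrow> nat) set" and A :: "(nat \<Rightarrow> nat) \<Rightarrow> real"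
  assumes "D \<ge> 1"
    and "transition_matrix D M"
    and "aperiodic_matrix D M"
    and "X = sft D M"
    and "seq_lipschitz_on X A"
    and "\<And>x. x \<in> X \<Longrightarrow> A x \<le> 0"
    and "max_integral X A = 0"
  shows "Liminf at_top (\<lambda>\<beta>. ereal (1 / \<beta>) * ereal_ln (pressure X A \<beta> - limit_entropy X A))
         \<ge> (SUP Cs\<in>{Cs. Cs \<noteq> [] \<and> distinct Cs \<and> set Cs \<subseteq> maximal_entropy_components X A}.
               component_eigenvalue X A Cs)"
proof (rule SUP_least)
  obtain L0 where L0: "\<forall>x\<in>X. \<forall>y\<in>X. \<bar>A x - A y\<bar> \<le> L0 * seq_dist x y"
    using assms(5) unfolding seq_lipschitz_on_def by blast
  \<comment> \<open>\<open>seq_lipschitz_on\<close> admits any real constant, whereas the error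
    estimates multiply inequalities by it; hence the absolute value.\<close>
  interpret sft_potential D M A X "\<bar>L0\<bar>"
  proof
    show "\<bar>A x - A y\<bar> \<le> \<bar>L0\<bar> * seq_dist x y" if "x \<in> X" "y \<in> X" for x y
    proof -
      have "L0 * seq_dist x y \<le> \<bar>L0\<bar> * seq_dist x y" by (intro mult_right_mono seq_dist_nonneg) simp
      then show ?thesis using L0 that by fastforce
    qed
  qed (use assms(4,6) in auto)
  fix Cs assume "Cs \<in> {Cs. Cs \<noteq> [] \<and> distinct Cs \<and> set Cs \<subseteq> maximal_entropy_components X A}"
  then have Cs: "Cs \<noteq> []" "set Cs \<subseteq> maximal_entropy_components X A" by auto
  have C: "C \<in> irreducible_components X A" "topological_entropy C = limit_entropy X A" if "C \<in> set Cs" for C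
    using Cs(2) that unfolding maximal_entropy_components_def by blast+
  have hd: "hd Cs \<in> irreducible_components X A" using C(1) Cs(1) by simp
  obtain h where "topological_entropy (hd Cs) = ereal h"
    using topological_entropy_word_count[OF finite_prefix_X[OF component_subset_X[OF hd]]
        component_suffix[OF hd] component_nonempty[OF hd]] by metis
  \<comment> \<open>The component itself shows that the limit is finite, so subtracting it from the
    pressure is harmless.\<close>
  then have h: "limit_entropy X A = ereal h" using C(2) Cs(1) by simp
  let ?R = "Liminf at_top (\<lambda>\<beta>. ereal (1 / \<beta>) * ereal_ln (pressure X A \<beta> - limit_entropy X A))"
  have mean: "cycle_mean (\<lambda>p q. S_ext X A (Cs ! q) (Cs ! p)) ls \<le> ?R"
    if ls: "ls \<noteq> []" "set ls \<subseteq> {0..<length Cs}" for ls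
  proof -
    define k where "k = length ls"
    have k: "k \<ge> 1" using ls(1) by (simp add: k_def Suc_le_eq)
    \<comment> \<open>The cycle, unrolled periodically; the index wrap of \<open>cycle_mean\<close>
      becomes a plain successor.\<close>
    define C' where "C' t = Cs ! (ls ! (t mod k))" for t
    have "ls ! (t mod k) \<in> set ls" for t using ls(1) by (intro nth_mem) (simp add: k_def)
    then have "C' t \<in> set Cs" for t unfolding C'_def using ls(2) by (intro nth_mem) fastforce
    then have C': "C' t \<in> irreducible_components X A" "topological_entropy (C' t) = ereal h" for t
      using C h by auto
    have "cycle_mean (\<lambda>p q. S_ext X A (Cs ! q) (Cs ! p)) ls = (\<Sum>t<k. S_ext X A (C' (Suc t)) (C' t)) / ereal k"
      unfolding cycle_mean_def by (simp add: k_def C'_def)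
    also have "\<dots> \<le> ?R" unfolding h
      by (rule liminf_cycle_mean[of k C' h, OF k C']) (simp add: C'_def)
    finally show ?thesis .
  qed
  let ?S = "{ls. ls \<noteq> [] \<and> distinct ls \<and> set ls \<subseteq> {0..<length Cs}}"
  have fin: "finite ?S"
    by (rule finite_subset[OF _ finite_subset_distinct[of "{0..<length Cs}"]]) auto
  have "[0] \<in> ?S" using Cs(1) by simp
  then have "?S \<noteq> {}" by blast
  then show "component_eigenvalue X A Cs \<le> ?R"
    unfolding component_eigenvalue_def maxplus_eigenvalue_def
    by (subst Max_le_iff) (use fin mean in auto)
qed

end
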